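(* Let $\Omega\subset\mathbb{R}^2$ be a bounded Lipschitz domain that is symmetric with respect to the $x_2$-axis, i.e., $\Omega=\Omega^+\cup L_0\cup\Omega^-$, where $\Omega^-$ is the reflection of $\Omega^+$ along the $x_2$-axis and $L_0$ is part of this axis. Let $r>0$ be such that $\overline{B_r^\pm}\subset\Omega$, where $B_r^\pm=B_r(\pm r,0)$, and let $\alpha>0$. Then for $g=\chi_{B_r^+}-\chi_{B_r^-}$ the minimizer $u\in BV(\Omega)\cap L^2(\Omega)$ of $$I(u)=|Du|(\Omega)+\frac{\alpha}{2}\|g-u\|^2$$ subject to $u|_{\partial\Omega}=0$ is given by $$u=c_{r,\alpha}\,g,\qquad c_{r,\alpha}=\max\{1-2/(\alpha r),0\}.$$
   Context: $|Du|(\Omega)$ denotes the total variation of $u$ on $\Omega$, i.e. $|Du|(\Omega)=\sup\{-\int_\Omega u\,\mathrm{div}\,\phi\,dx:\phi\in C_c^\infty(\Omega;\mathbb{R}^2),\ |\phi|\le 1\}$. $\|\cdot\|$ is the norm of $L^2(\Omega)$. $B_r(x)$ is the open ball of radius $r$ centered at $x$; $\chi_A$ is the characteristic function of $A$. $\Omega^\pm$ are the parts of $\Omega$ lying in $\{\pm x_1>0\}$, so symmetry means invariance of $\Omega$ under $(x_1,x_2)\mapsto(-x_1,x_2)$. The boundary condition $u|_{\partial\Omega}=0$ is understood in the sense of traces of $BV$ functions. *)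

theory Defs
  imports "HOL-Analysis.Analysis"
begin

section \<open>Smooth vector fields and test fields\<close>

primrec Ck :: "nat \<Rightarrow> (real^2 \<Rightarrow> real^2) \<Rightarrow> bool" where
  "Ck 0 f \<longleftrightarrow> continuous_on UNIV f"
| "Ck (Suc k) f \<longleftrightarrow> (\<forall>x. f differentiable (at x)) \<and>
     (\<forall>v. Ck k (\<lambda>x. frechet_derivative f (at x) v))"

definition divergence :: "(real^2 \<Rightarrow> real^2) \<Rightarrow> real^2 \<Rightarrow> real" where
  "divergence \<phi> x = (\<Sum>i\<in>UNIV. frechet_derivative \<phi> (at x) (axis i 1) $ i)"

text \<open>Elements of \<open>C\<^sub>c\<^sup>\<infinity>(\<Omega>; \<real>\<^sup>2)\<close> are represented by their extensions by zero to the whole plane.\<close>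

definition test_fields :: "(real^2) set \<Rightarrow> (real^2 \<Rightarrow> real^2) set" where
  "test_fields \<Omega> = {\<phi>. (\<forall>k. Ck k \<phi>) \<and> compact (closure {x. \<phi> x \<noteq> 0}) \<and>
     closure {x. \<phi> x \<noteq> 0} \<subseteq> \<Omega>}"

section \<open>Functions of bounded variation\<close>

text \<open>Functions on \<open>\<Omega>\<close> are total functions of which only the values on \<open>\<Omega>\<close> matter, and
  elements of the Lebesgue spaces are represented by functions, not by classes modulo null sets.\<close>

definition total_variation :: "(real^2) set \<Rightarrow> (real^2 \<Rightarrow> real) \<Rightarrow> ereal" where
  "total_variation \<Omega> u =
     (SUP \<phi>\<in>{\<phi> \<in> test_fields \<Omega>. \<forall>x. norm (\<phi> x) \<le> 1}.
        ereal (- (LINT x|lebesgue_on \<Omega>. u x * divergence \<phi> x)))"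

definition BV :: "(real^2) set \<Rightarrow> (real^2 \<Rightarrow> real) set" where
  "BV \<Omega> = {u. integrable (lebesgue_on \<Omega>) u \<and> total_variation \<Omega> u < \<infinity>}"

definition L2 :: "(real^2) set \<Rightarrow> (real^2 \<Rightarrow> real) set" where
  "L2 \<Omega> = {u. u \<in> borel_measurable (lebesgue_on \<Omega>) \<and>
     integrable (lebesgue_on \<Omega>) (\<lambda>x. (u x)\<^sup>2)}"

definition L2_norm :: "(real^2) set \<Rightarrow> (real^2 \<Rightarrow> real) \<Rightarrow> real" where
  "L2_norm \<Omega> u = sqrt (LINT x|lebesgue_on \<Omega>. (u x)\<^sup>2)"

section \<open>Lipschitz domains\<close>

definition lipschitz_domain :: "(real^2) set \<Rightarrow> bool" where
  "lipschitz_domain \<Omega> \<longleftrightarrow> open \<Omega> \<and> connected \<Omega> \<and> \<Omega> \<noteq> {} \<and>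
     (\<forall>x\<in>frontier \<Omega>. \<exists>\<rho>>0. \<exists>Q :: real^2 \<Rightarrow> real^2. \<exists>\<gamma> :: real \<Rightarrow> real. \<exists>L.
        orthogonal_transformation Q \<and> L-lipschitz_on UNIV \<gamma> \<and>
        (\<forall>y\<in>ball x \<rho>. y \<in> \<Omega> \<longleftrightarrow> \<gamma> (Q y $ 1) < Q y $ 2))"

section \<open>One-dimensional Hausdorff measure and outer normal\<close>

definition hausdorff1_outer :: "(real^2) set \<Rightarrow> ennreal" where
  "hausdorff1_outer A =
     (SUP \<delta>\<in>{0<..}. INF E\<in>{E :: nat \<Rightarrow> (real^2) set. A \<subseteq> (\<Union>i. E i) \<and>
          (\<forall>i. bounded (E i) \<and> diameter (E i) \<le> \<delta>)}.
        \<Sum>i. ennreal (diameter (E i)))"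

text \<open>\<open>measure_of\<close> requires its argument to be countably additive on the given sets to be
  meaningful; this holds here because \<open>hausdorff1_outer\<close> is a metric outer measure
  (Caratheodory's criterion).\<close>

definition hausdorff1 :: "(real^2) measure" where
  "hausdorff1 = measure_of UNIV (sets borel) hausdorff1_outer"

text \<open>The measure-theoretic exterior unit normal. For a Lipschitz domain it exists, is unique and
  agrees with the classical normal of the boundary graph at almost every boundary point with
  respect to \<open>hausdorff1\<close>.\<close>

definition is_outer_normal :: "(real^2) set \<Rightarrow> real^2 \<Rightarrow> real^2 \<Rightarrow> bool" where
  "is_outer_normal \<Omega> x n \<longleftrightarrow> norm n = 1 \<and>
     ((\<lambda>\<rho>. measure lebesgue {y \<in> ball x \<rho> \<inter> \<Omega>. (y - x) \<bullet> n > 0} / \<rho>\<^sup>2) \<longlongrightarrow> 0) (at_right 0) \<and>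
     ((\<lambda>\<rho>. measure lebesgue {y \<in> ball x \<rho> - \<Omega>. (y - x) \<bullet> n < 0} / \<rho>\<^sup>2) \<longlongrightarrow> 0) (at_right 0)"

definition outer_normal :: "(real^2) set \<Rightarrow> real^2 \<Rightarrow> real^2" where
  "outer_normal \<Omega> x =
     (if \<exists>n. is_outer_normal \<Omega> x n then THE n. is_outer_normal \<Omega> x n else 0)"

section \<open>Traces of BV functions\<close>

text \<open>The distributional gradient \<open>Du\<close> as a finite vector measure on \<open>\<Omega>\<close>, given by its polar
  decomposition \<open>Du = \<sigma> \<mu>\<close> with \<open>\<mu> = |Du|\<close> and \<open>|\<sigma>| = 1\<close>.\<close>

definition is_gradient_measure ::
    "(real^2) set \<Rightarrow> (real^2 \<Rightarrow> real) \<Rightarrow> (real^2) measure \<Rightarrow> (real^2 \<Rightarrow> real^2) \<Rightarrow> bool" where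
  "is_gradient_measure \<Omega> u \<mu> \<sigma> \<longleftrightarrow>
     sets \<mu> = sets (restrict_space borel \<Omega>) \<and> finite_measure \<mu> \<and>
     \<sigma> \<in> borel_measurable \<mu> \<and> (AE x in \<mu>. norm (\<sigma> x) = 1) \<and>
     (\<forall>\<phi>\<in>test_fields \<Omega>.
        (LINT x|lebesgue_on \<Omega>. u x * divergence \<phi> x) = - (LINT x|\<mu>. \<phi> x \<bullet> \<sigma> x))"

text \<open>For a bounded Lipschitz domain \<open>\<Omega>\<close>, \<open>T\<close> is (a representative of) the trace of
  \<open>u \<in> BV(\<Omega>)\<close>: the function in \<open>L\<^sup>1(\<partial>\<Omega>)\<close>, unique up
  to null sets of \<open>hausdorff1\<close>, for which the Gauss-Green formula holds for all
  \<open>\<phi> \<in> C\<^sup>1(\<real>\<^sup>2; \<real>\<^sup>2)\<close> (the definition of Evans and Gariepy). The gradient measure is determined by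
  \<open>u\<close> and exists by the Riesz representation theorem.\<close>

definition has_trace :: "(real^2) set \<Rightarrow> (real^2 \<Rightarrow> real) \<Rightarrow> (real^2 \<Rightarrow> real) \<Rightarrow> bool" where
  "has_trace \<Omega> u T \<longleftrightarrow> u \<in> BV \<Omega> \<and> set_integrable hausdorff1 (frontier \<Omega>) T \<and>
     (\<exists>\<mu> \<sigma>. is_gradient_measure \<Omega> u \<mu> \<sigma> \<and>
       (\<forall>\<phi>. Ck 1 \<phi> \<longrightarrow>
          (LINT x|lebesgue_on \<Omega>. u x * divergence \<phi> x) =
            - (LINT x|\<mu>. \<phi> x \<bullet> \<sigma> x) +
            (LINT x:frontier \<Omega>|hausdorff1. (\<phi> x \<bullet> outer_normal \<Omega> x) * T x)))"

section \<open>The minimization problem\<close>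

definition functional_I ::
    "(real^2) set \<Rightarrow> real \<Rightarrow> (real^2 \<Rightarrow> real) \<Rightarrow> (real^2 \<Rightarrow> real) \<Rightarrow> ereal" where
  "functional_I \<Omega> \<alpha> g u =
     total_variation \<Omega> u + ereal (\<alpha> / 2 * (L2_norm \<Omega> (\<lambda>x. g x - u x))\<^sup>2)"

definition admissible :: "(real^2) set \<Rightarrow> (real^2 \<Rightarrow> real) set" where
  "admissible \<Omega> = {u \<in> BV \<Omega> \<inter> L2 \<Omega>. has_trace \<Omega> u (\<lambda>_. 0)}"

definition is_minimizer ::
    "(real^2) set \<Rightarrow> real \<Rightarrow> (real^2 \<Rightarrow> real) \<Rightarrow> (real^2 \<Rightarrow> real) \<Rightarrow> bool" where
  "is_minimizer \<Omega> \<alpha> g u \<longleftrightarrow>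
     u \<in> admissible \<Omega> \<and> (\<forall>v\<in>admissible \<Omega>. functional_I \<Omega> \<alpha> g u \<le> functional_I \<Omega> \<alpha> g v)"

end

theory Submission
  imports Defs
begin

text \<open>The statement is proved by calibration. Suppose that there is a vector field \<open>z\<close> on the whole plane with
\<open>|z| \<le> 1\<close> and \<open>div z = - (2 / r) g\<close>. For a competitor \<open>v\<close> with zero trace no boundary term appears when
\<open>v\<close> is tested with \<open>z\<close>, although \<open>z\<close> does not vanish on the boundary of \<open>\<Omega>\<close>, and therefore
\<open>|Dv|(\<Omega>) \<ge> - \<integral> v div z = (2 / r) \<integral> v g\<close>. Since \<open>|Dv|(\<Omega>) \<ge> 0\<close> as well, the factor \<open>2 / r\<close>
may be lowered to any \<open>\<kappa>\<close> between \<open>0\<close> and \<open>2 / r\<close>. With \<open>\<kappa> = \<alpha> (1 - c)\<close>, which is the minimum of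
\<open>2 / r\<close> and \<open>\<alpha>\<close>, completing the square gives
\<open>I(v) \<ge> \<kappa> \<integral> v g + (\<alpha> / 2) \<parallel>g - v\<parallel>\<^sup>2 = K + (\<alpha> / 2) \<parallel>v - c g\<parallel>\<^sup>2\<close>
with a constant \<open>K\<close>. On the other hand \<open>c g\<close> has variation at most \<open>4 \<pi> r c\<close>, the jump \<open>c\<close> times the
length of the two circles, which equals \<open>\<kappa> \<integral> (c g) g\<close>; hence \<open>I(c g) \<le> K\<close>. Both minimality and uniqueness
follow.

The field is obtained by folding the plane along the axis \<open>x\<^sub>1 = 0\<close>. For one disc with centre \<open>p = (r, 0)\<close>
the field \<open>F(y) = - (y - p) min (1 / r) (r / |y - p|\<^sup>2)\<close> has norm at most 1, divergence \<open>- 2 / r\<close> in the disc and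
divergence 0 outside. If \<open>\<theta>\<close> is a real function with \<open>|\<theta>'| \<le> 1\<close>, then
\<open>z(x) = (F\<^sub>1(\<theta>(x\<^sub>1), x\<^sub>2), \<theta>'(x\<^sub>1) F\<^sub>2(\<theta>(x\<^sub>1), x\<^sub>2))\<close>
still has norm at most 1, and \<open>div z = \<theta>'(x\<^sub>1) (div F)(\<theta>(x\<^sub>1), x\<^sub>2)\<close>. For \<open>\<theta>(s) = |s|\<close> this is the
required field for both discs at once. It is replaced here by explicit smooth approximations: \<open>|s|\<close> by
\<open>sqrt (s\<^sup>2 + \<epsilon>\<^sup>2)\<close>, and \<open>min 1 (1 / t)\<close> by \<open>(1 + t\<^sup>N)\<close> to the power \<open>- 1 / N\<close>. They keep
the norm bound exactly (\<open>norm_calibration_le\<close>), and their divergences are bounded and converge almost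
everywhere (\<open>tendsto_divergence_calibration\<close>), which is enough by dominated convergence
(\<open>total_variation_ge_signed_balls\<close>).

That the zero trace permits fields without compact support is \<open>total_variation_ge_of_zero_trace\<close>: the
definition of the trace represents \<open>\<integral> v div z\<close> by the gradient measure of \<open>v\<close>, a finite measure on the
open set \<open>\<Omega>\<close>, and smooth cutoffs tending to 1 on \<open>\<Omega>\<close> exhaust it.

For the upper bound, and in order to see that \<open>c g\<close> is admissible at all, its gradient measure is given
explicitly: \<open>c\<close> times arc length on the two circles, with the normal direction. This rests on the
divergence theorem for discs (\<open>divergence_theorem_disc\<close>), obtained from polar coordinates.\<close>

section \<open>Calculus of smooth functions\<close>

text \<open>The same recursion as in the definition of \<open>Ck\<close>, for arbitrary normed spaces: smooth vector fields are
assembled from scalar functions, so the closure properties are needed for both.\<close>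

primrec cont_diff :: "nat \<Rightarrow> ('a::real_normed_vector \<Rightarrow> 'b::real_normed_vector) \<Rightarrow> bool" where
  "cont_diff 0 f \<longleftrightarrow> continuous_on UNIV f"
| "cont_diff (Suc k) f \<longleftrightarrow> (\<forall>x. f differentiable (at x)) \<and>
     (\<forall>v. cont_diff k (\<lambda>x. frechet_derivative f (at x) v))"

lemma Ck_eq_cont_diff: "Ck k f = cont_diff k f"
  by (induction k arbitrary: f) auto

lemma cont_diff_SucI:
  assumes "\<And>x. (f has_derivative f' x) (at x)" and "\<And>v. cont_diff k (\<lambda>x. f' x v)"
  shows "cont_diff (Suc k) f"
proof -
  have "frechet_derivative f (at x) = f' x" for x
    using assms(1) frechet_derivative_at by metis
  then show ?thesis
    using assms by (auto simp: differentiable_def)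
qed

lemma cont_diff_SucE:
  assumes "cont_diff (Suc k) f"
  obtains f' where "\<And>x. (f has_derivative f' x) (at x)" and "\<And>v. cont_diff k (\<lambda>x. f' x v)"
  using assms frechet_derivative_works by (metis cont_diff.simps(2))

lemma cont_diff_Suc_imp: "cont_diff (Suc k) f \<Longrightarrow> cont_diff k f"
proof (induction k arbitrary: f)
  case 0
  then show ?case
    by (auto intro!: differentiable_imp_continuous_on simp: differentiable_on_def)
next
  case (Suc k)
  then show ?case by (metis cont_diff.simps(2))
qed

lemma cont_diff_const: "cont_diff k (\<lambda>x. c)"
  by (induction k arbitrary: c) (auto intro!: continuous_intros cont_diff_SucI derivative_eq_intros)

lemma cont_diff_bounded_linear: "bounded_linear f \<Longrightarrow> cont_diff k f"
proof (cases k)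
  case 0
  assume "bounded_linear f"
  with 0 show ?thesis by (simp add: linear_continuous_on)
next
  case (Suc n)
  assume "bounded_linear f"
  then show ?thesis unfolding Suc
    by (intro cont_diff_SucI[where f' = "\<lambda>x. f"] bounded_linear_imp_has_derivative cont_diff_const)
qed

lemma cont_diff_add:
  "cont_diff k f \<Longrightarrow> cont_diff k g \<Longrightarrow> cont_diff k (\<lambda>x. f x + g x)"
proof (induction k arbitrary: f g)
  case 0
  then show ?case by (auto intro: continuous_intros)
next
  case (Suc k)
  obtain f' where f': "\<And>x. (f has_derivative f' x) (at x)" "\<And>v. cont_diff k (\<lambda>x. f' x v)"
    using cont_diff_SucE[OF Suc.prems(1)] by blast
  obtain g' where g': "\<And>x. (g has_derivative g' x) (at x)" "\<And>v. cont_diff k (\<lambda>x. g' x v)"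
    using cont_diff_SucE[OF Suc.prems(2)] by blast
  show ?case
    by (rule cont_diff_SucI[where f' = "\<lambda>x v. f' x v + g' x v"])
      (auto intro!: has_derivative_add f' g' Suc.IH)
qed

lemma cont_diff_bilinear:
  assumes "bounded_bilinear h"
  shows "cont_diff k f \<Longrightarrow> cont_diff k g \<Longrightarrow> cont_diff k (\<lambda>x. h (f x) (g x))"
proof (induction k arbitrary: f g)
  case 0
  then show ?case by (auto intro: bounded_bilinear.continuous_on[OF assms])
next
  case (Suc k)
  obtain f' where f': "\<And>x. (f has_derivative f' x) (at x)" "\<And>v. cont_diff k (\<lambda>x. f' x v)"
    using cont_diff_SucE[OF Suc.prems(1)] by blast
  obtain g' where g': "\<And>x. (g has_derivative g' x) (at x)" "\<And>v. cont_diff k (\<lambda>x. g' x v)"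
    using cont_diff_SucE[OF Suc.prems(2)] by blast
  have "((\<lambda>x. h (f x) (g x)) has_derivative (\<lambda>v. h (f x) (g' x v) + h (f' x v) (g x))) (at x)" for x
    using bounded_bilinear.FDERIV[OF assms f'(1) g'(1)] .
  then show ?case
    using Suc.prems[THEN cont_diff_Suc_imp] f'(2) g'(2)
    by (intro cont_diff_SucI[OF _ cont_diff_add[OF Suc.IH Suc.IH]])
qed

lemmas cont_diff_mult = cont_diff_bilinear[OF bounded_bilinear_mult]
lemmas cont_diff_scaleR = cont_diff_bilinear[OF bounded_bilinear_scaleR]

text \<open>The outer function enters together with all its derivatives \<open>D n\<close>, because the induction on the order of
differentiability passes from \<open>D n\<close> to \<open>D (Suc n)\<close>. They are only required on a set \<open>S\<close> containing the
values of \<open>f\<close>, so that powers with real exponents on the positive half-line are covered.\<close>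

lemma cont_diff_compose_real:
  fixes D :: "nat \<Rightarrow> real \<Rightarrow> real"
  assumes D: "\<And>n t. t \<in> S \<Longrightarrow> (D n has_real_derivative D (Suc n) t) (at t)"
    and S: "\<And>x. f x \<in> S"
  shows "cont_diff k f \<Longrightarrow> cont_diff k (\<lambda>x. D n (f x))"
proof (induction k arbitrary: n)
  case 0
  have "continuous_on S (D n)"
    using D by (meson DERIV_isCont continuous_at_imp_continuous_on)
  with 0 S show ?case
    using continuous_on_compose2[of S "D n" UNIV f] by auto
next
  case (Suc k)
  obtain f' where f': "\<And>x. (f has_derivative f' x) (at x)" "\<And>v. cont_diff k (\<lambda>x. f' x v)"
    using cont_diff_SucE[OF Suc.prems(1)] by blast
  have "((\<lambda>x. D n (f x)) has_derivative (\<lambda>v. f' x v * D (Suc n) (f x))) (at x)" for x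
    using D[OF S, of n x] f'(1)[of x] by (auto intro: DERIV_compose_FDERIV)
  then show ?case
    by (intro cont_diff_SucI[OF _ cont_diff_mult[OF f'(2) Suc.IH[OF cont_diff_Suc_imp[OF Suc.prems]]]])
qed

lemma cont_diff_power:
  fixes f :: "'a::real_normed_vector \<Rightarrow> real"
  shows "cont_diff k f \<Longrightarrow> cont_diff k (\<lambda>x. f x ^ n)"
  by (induction n) (auto intro: cont_diff_const cont_diff_mult)

lemma cont_diff_diff:
  fixes f g :: "'a::real_normed_vector \<Rightarrow> real"
  assumes "cont_diff k f" "cont_diff k g" shows "cont_diff k (\<lambda>x. f x - g x)"
  using cont_diff_add[OF assms(1) cont_diff_mult[OF cont_diff_const[of k "-1"] assms(2)]] by simp

lemma cont_diff_prod:
  fixes f :: "'i \<Rightarrow> 'a::real_normed_vector \<Rightarrow> real"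
  assumes "\<And>i. i \<in> I \<Longrightarrow> cont_diff k (f i)"
  shows "cont_diff k (\<lambda>x. \<Prod>i\<in>I. f i x)"
  using assms by (induction I rule: infinite_finite_induct) (auto intro: cont_diff_const cont_diff_mult)

lemma cont_diff_powr:
  fixes f :: "'a::real_normed_vector \<Rightarrow> real"
  assumes "\<And>x. f x > 0" "cont_diff k f"
  shows "cont_diff k (\<lambda>x. f x powr a)"
proof -
  define D where "D n t = (\<Prod>j<n. a - real j) * t powr (a - real n)" for n t
  have "(D n has_real_derivative D (Suc n) t) (at t)" if "t \<in> {0<..}" for n t
  proof -
    have "(D n has_real_derivative (\<Prod>j<n. a - real j) * ((a - real n) * t powr (a - real n - 1))) (at t)"
      unfolding D_def using that by (intro DERIV_cmult has_real_derivative_powr) simp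
    then show ?thesis
      by (simp add: D_def diff_diff_eq mult.assoc add.commute)
  qed
  from cont_diff_compose_real[of "{0<..}" D f k 0, OF this] assms show ?thesis
    by (simp add: D_def)
qed

section \<open>A smooth cutoff of an open set\<close>

text \<open>The function that is \<open>exp (- 1 / t)\<close> for \<open>t > 0\<close> and \<open>0\<close> otherwise is smooth: its derivative of
order \<open>n\<close> at \<open>t > 0\<close> is \<open>P\<^sub>n(1 / t) exp (- 1 / t)\<close> for polynomials with
\<open>P\<^sub>n\<^sub>+\<^sub>1(y) = y\<^sup>2 (P\<^sub>n(y) - P\<^sub>n'(y))\<close>.\<close>

primrec bump_poly :: "nat \<Rightarrow> real poly" where
  "bump_poly 0 = 1"
| "bump_poly (Suc n) = [:0, 0, 1:] * (bump_poly n - pderiv (bump_poly n))"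

definition bump_deriv :: "nat \<Rightarrow> real \<Rightarrow> real" where
  "bump_deriv n t = (if t > 0 then poly (bump_poly n) (1 / t) * exp (- (1 / t)) else 0)"

lemma poly_times_exp_tendsto_0: "((\<lambda>y. poly p y * exp (- y)) \<longlongrightarrow> (0::real)) at_top"
proof -
  have "((\<lambda>y::real. \<Sum>i\<le>degree p. coeff p i * (y ^ i / exp y)) \<longlongrightarrow> (\<Sum>i\<le>degree p. coeff p i * 0)) at_top"
    by (intro tendsto_intros tendsto_power_div_exp_0)
  then show ?thesis
    by (simp add: poly_altdef sum_distrib_right exp_minus divide_inverse mult.assoc)
qed

text \<open>The case of interest is \<open>t = 0\<close>: the difference quotient from the right is \<open>y P\<^sub>n(y) exp (- y)\<close>
with \<open>y = 1 / t\<close>, and the exponential beats the polynomial.\<close>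

lemma bump_deriv_has_derivative:
  "(bump_deriv n has_real_derivative bump_deriv (Suc n) t) (at t)"
proof -
  consider "t > 0" | "t < 0" | "t = 0" by linarith
  then show ?thesis
  proof cases
    case 1
    have "((\<lambda>t. poly (bump_poly n) (1 / t) * exp (- (1 / t))) has_real_derivative bump_deriv (Suc n) t) (at t)"
    proof -
      have i: "((\<lambda>t. 1 / t) has_real_derivative - ((1 / t) * (1 / t))) (at t)"
        using 1 by (auto intro!: derivative_eq_intros)
      have "((\<lambda>t. poly (bump_poly n) (1 / t) * exp (- (1 / t))) has_real_derivative
          poly (pderiv (bump_poly n)) (1 / t) * - ((1 / t) * (1 / t)) * exp (- (1 / t)) +
          exp (- (1 / t)) * - (- ((1 / t) * (1 / t))) * poly (bump_poly n) (1 / t)) (at t)"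
        by (intro DERIV_mult DERIV_chain2[OF poly_DERIV i] DERIV_chain2[OF DERIV_exp DERIV_minus[OF i]])
      then show ?thesis
        using 1 by (simp add: bump_deriv_def algebra_simps)
    qed
    then show ?thesis
      by (rule has_field_derivative_transform_within_open[where S = "{0<..}"])
        (use 1 in \<open>auto simp: bump_deriv_def\<close>)
  next
    case 2
    show ?thesis
      by (rule has_field_derivative_transform_within_open[where S = "{..<0}" and f = "\<lambda>_. 0"])
        (use 2 in \<open>auto simp: bump_deriv_def\<close>)
  next
    case 3
    have "((\<lambda>y. poly ([:0,1:] * bump_poly n) (inverse y) * exp (- inverse y)) \<longlongrightarrow> 0) (at_right (0::real))"
      using poly_times_exp_tendsto_0 filterlim_inverse_at_top_right by (rule filterlim_compose)
    then have r: "((\<lambda>y. bump_deriv n y / y) \<longlongrightarrow> 0) (at_right 0)"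
      by (rule Lim_transform_eventually) 
        (auto simp: eventually_at_filter bump_deriv_def field_simps)
    have "((\<lambda>y. bump_deriv n y / y) \<longlongrightarrow> 0) (at_left 0)"
      by (rule tendsto_eventually) (auto simp: eventually_at_filter bump_deriv_def)
    with r have "((\<lambda>y. bump_deriv n y / y) \<longlongrightarrow> 0) (at 0)"
      by (simp add: filterlim_at_split)
    then show ?thesis using 3
      by (simp add: has_field_derivative_iff bump_deriv_def)
  qed
qed

lemma smooth_bump_on_ball:
  fixes c :: "'a::euclidean_space"
  obtains b :: "'a \<Rightarrow> real" where "\<And>k. cont_diff k b" "\<And>x. 0 \<le> b x" "\<And>x. b x < 1"
    "\<And>x. b x > 0 \<longleftrightarrow> x \<in> ball c \<rho>"
proof (cases "\<rho> > 0")
  case False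
  then show ?thesis by (intro that[of "\<lambda>_. 0"]) (auto intro: cont_diff_const simp: not_less order.trans[OF _ zero_le_dist])
next
  case True
  \<comment> \<open>The argument is a polynomial in the coordinates that is positive exactly on the ball.\<close>
  define b where "b x = bump_deriv 0 (\<rho>\<^sup>2 - (x - c) \<bullet> (x - c))" for x
  have id: "cont_diff k (\<lambda>x. x - c)" for k
    using cont_diff_add[OF cont_diff_bounded_linear[OF bounded_linear_ident] cont_diff_const[of k "-c"]] by simp
  have "cont_diff k b" for k
  proof -
    have "cont_diff k (\<lambda>x. \<rho>\<^sup>2 - (x - c) \<bullet> (x - c))"
      by (intro cont_diff_diff cont_diff_const cont_diff_bilinear[OF bounded_bilinear_inner] id)
    then show ?thesis
      unfolding b_def
      by (intro cont_diff_compose_real[where S = UNIV and D = bump_deriv] bump_deriv_has_derivative) auto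
  qed
  moreover have "b x > 0 \<longleftrightarrow> x \<in> ball c \<rho>" for x
  proof -
    have "x \<in> ball c \<rho> \<longleftrightarrow> (norm (x - c))\<^sup>2 < \<rho>\<^sup>2"
      using True power_mono_iff[of \<rho> "norm (x - c)" 2]
      by (auto simp: dist_norm norm_minus_commute simp flip: not_le)
    then show ?thesis
      by (auto simp: b_def bump_deriv_def dot_square_norm)
  qed
  ultimately show ?thesis
    by (intro that[of b]) (auto simp: b_def bump_deriv_def)
qed

text \<open>Cover \<open>\<Omega>\<close> by countably many balls whose closures lie in \<open>\<Omega>\<close> and let \<open>b\<^sub>i\<close>, with values in \<open>[0, 1)\<close>, be
a smooth bump that is positive exactly on the ball of index \<open>i\<close>. The cutoff
\<open>1 - (\<Prod>i<n. (1 - b\<^sub>i) ^ n)\<close> is supported in the first \<open>n\<close> closed balls, and on the ball of index \<open>j\<close> it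
converges to 1 because already the factor \<open>(1 - b\<^sub>j) ^ n\<close> tends to 0. The exponent spares
a construction of bumps that are constantly 1 on a smaller ball.\<close>

lemma smooth_cutoffs:
  fixes \<Omega> :: "'a::euclidean_space set"
  assumes "open \<Omega>"
  obtains \<eta> :: "nat \<Rightarrow> 'a \<Rightarrow> real" where
    "\<And>n k. cont_diff k (\<eta> n)" "\<And>n x. 0 \<le> \<eta> n x" "\<And>n x. \<eta> n x \<le> 1"
    "\<And>n. compact (closure {x. \<eta> n x \<noteq> 0})" "\<And>n. closure {x. \<eta> n x \<noteq> 0} \<subseteq> \<Omega>"
    "\<And>x. x \<in> \<Omega> \<Longrightarrow> (\<lambda>n. \<eta> n x) \<longlonglongrightarrow> 1"
proof -
  define F where "F = {ball c \<rho> |c \<rho>. cball c \<rho> \<subseteq> \<Omega>}"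
  have "open U" if "U \<in> F" for U
    using that by (auto simp: F_def)
  then obtain G where G: "G \<subseteq> F" "countable G" "\<Union>G = \<Union>F"
    using Lindelof[of F] by metis
  \<comment> \<open>The empty ball is added so that the enumeration below also works for empty \<open>\<Omega>\<close>.\<close>
  have "ball 0 (-1) \<in> F"
    unfolding F_def by force
  moreover have "ball 0 (-1) = ({} :: 'a set)" by simp
  ultimately have "{} \<in> F" by metis
  with G have G': "insert {} G \<subseteq> F" "countable (insert {} G)" "insert {} G \<noteq> {}" by auto
  have UG: "\<Omega> \<subseteq> \<Union>G"
  proof
    fix x assume "x \<in> \<Omega>"
    then obtain \<rho> where "\<rho> > 0" "cball x \<rho> \<subseteq> \<Omega>"
      using \<open>open \<Omega>\<close> open_contains_cball by blast
    then have "ball x \<rho> \<in> F" "x \<in> ball x \<rho>" by (auto simp: F_def)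
    then show "x \<in> \<Union>G" using G(3) by blast
  qed
  define B where "B = from_nat_into (insert {} G)"
  have rB: "range B = insert {} G"
    unfolding B_def using G' by (intro range_from_nat_into) auto
  have "\<forall>i. \<exists>c \<rho>. B i = ball c \<rho> \<and> cball c \<rho> \<subseteq> \<Omega>"
  proof
    fix i
    have "B i \<in> F" using rB G'(1) by (metis rangeI subsetD)
    then show "\<exists>c \<rho>. B i = ball c \<rho> \<and> cball c \<rho> \<subseteq> \<Omega>" by (auto simp: F_def)
  qed
  then obtain c \<rho> where c: "\<And>i. B i = ball (c i) (\<rho> i)" "\<And>i. cball (c i) (\<rho> i) \<subseteq> \<Omega>"
    by metis
  have "\<forall>i. \<exists>b :: 'a \<Rightarrow> real. (\<forall>k. cont_diff k b) \<and> (\<forall>x. 0 \<le> b x) \<and> (\<forall>x. b x < 1) \<and>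
      (\<forall>x. b x > 0 \<longleftrightarrow> x \<in> ball (c i) (\<rho> i))"
  proof
    fix i
    obtain b :: "'a \<Rightarrow> real" where "\<And>k. cont_diff k b" "\<And>x. 0 \<le> b x" "\<And>x. b x < 1"
      "\<And>x. b x > 0 \<longleftrightarrow> x \<in> ball (c i) (\<rho> i)"
      using smooth_bump_on_ball[of "c i" "\<rho> i"] by metis
    then show "\<exists>b :: 'a \<Rightarrow> real. (\<forall>k. cont_diff k b) \<and> (\<forall>x. 0 \<le> b x) \<and> (\<forall>x. b x < 1) \<and>
      (\<forall>x. b x > 0 \<longleftrightarrow> x \<in> ball (c i) (\<rho> i))"
      by (intro exI[of _ b]) blast
  qed
  from choice[OF this] obtain b :: "nat \<Rightarrow> 'a \<Rightarrow> real" where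
    b': "\<forall>i. (\<forall>k. cont_diff k (b i)) \<and> (\<forall>x. 0 \<le> b i x) \<and> (\<forall>x. b i x < 1) \<and>
      (\<forall>x. b i x > 0 \<longleftrightarrow> x \<in> ball (c i) (\<rho> i))" ..
  then have b: "\<And>i k. cont_diff k (b i)" "\<And>i x. 0 \<le> b i x" "\<And>i x. b i x < 1"
    "\<And>i x. b i x > 0 \<longleftrightarrow> x \<in> ball (c i) (\<rho> i)"
    by blast+
  define \<eta> where "\<eta> n x = 1 - (\<Prod>i<n. (1 - b i x) ^ n)" for n x
  have prod01: "0 \<le> (\<Prod>i<n. (1 - b i x) ^ n)" "(\<Prod>i<n. (1 - b i x) ^ n) \<le> 1" for n x
    using b(2,3) by (auto intro!: prod_nonneg prod_le_1 power_le_one simp: less_imp_le)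
  have supp: "closure {x. \<eta> n x \<noteq> 0} \<subseteq> (\<Union>i<n. cball (c i) (\<rho> i))" for n
  proof (rule closure_minimal)
    show "{x. \<eta> n x \<noteq> 0} \<subseteq> (\<Union>i<n. cball (c i) (\<rho> i))"
    proof
      fix x assume "x \<in> {x. \<eta> n x \<noteq> 0}"
      then have "(\<Prod>i<n. (1 - b i x) ^ n) \<noteq> 1" by (simp add: \<eta>_def)
      then have "\<not> (\<forall>i\<in>{..<n}. (1 - b i x) ^ n = 1)"
        using prod.neutral[of "{..<n}" "\<lambda>i. (1 - b i x) ^ n"] by argo
      then obtain i where i: "i < n" "b i x \<noteq> 0"
        by (metis diff_zero lessThan_iff power_one)
      then have "b i x > 0" using b(2)[of i x] by simp
      then show "x \<in> (\<Union>i<n. cball (c i) (\<rho> i))" using i b(4) ball_subset_cball by blast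
    qed
  qed (intro closed_UN, auto)
  show ?thesis
  proof
    show "cont_diff k (\<eta> n)" for n k
      unfolding \<eta>_def
      by (intro cont_diff_diff cont_diff_const cont_diff_prod cont_diff_power b)
    show "0 \<le> \<eta> n x" "\<eta> n x \<le> 1" for n x
      using prod01[of x n] by (auto simp: \<eta>_def)
    show "compact (closure {x. \<eta> n x \<noteq> 0})" for n
    proof -
      have "compact (\<Union>i<n. cball (c i) (\<rho> i))" by (intro compact_UN) auto
      then show ?thesis
        using supp[of n] by (meson bounded_subset closed_closure compact_eq_bounded_closed)
    qed
    show "closure {x. \<eta> n x \<noteq> 0} \<subseteq> \<Omega>" for n
      using supp[of n] c(2) by blast
    show "(\<lambda>n. \<eta> n x) \<longlonglongrightarrow> 1" if "x \<in> \<Omega>" for x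
    proof -
      obtain U where "U \<in> G" "x \<in> U"
        using UG \<open>x \<in> \<Omega>\<close> by blast
      then have "U \<in> range B" using rB by simp
      then obtain j where j: "x \<in> B j"
        using \<open>x \<in> U\<close> by blast
      then have bj: "b j x > 0" using b(4) c by simp
      have "(\<lambda>n. (1 - b j x) ^ n) \<longlonglongrightarrow> 0"
        using bj b(3)[of j x] by (intro LIMSEQ_power_zero) auto
      moreover have le: "\<forall>\<^sub>F n in sequentially. (\<Prod>i<n. (1 - b i x) ^ n) \<le> (1 - b j x) ^ n"
        using eventually_gt_at_top[of j]
      proof eventually_elim
        case (elim n)
        have "(\<Prod>i<n. (1 - b i x) ^ n) = (1 - b j x) ^ n * (\<Prod>i\<in>{..<n} - {j}. (1 - b i x) ^ n)"
          using elim by (intro prod.remove) auto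
        also have "\<dots> \<le> (1 - b j x) ^ n * 1"
          using b(2,3) by (intro mult_left_mono prod_le_1) (auto intro!: power_le_one simp: less_imp_le)
        finally show ?case by simp
      qed
      ultimately have "(\<lambda>n. \<Prod>i<n. (1 - b i x) ^ n) \<longlonglongrightarrow> 0"
        by (intro tendsto_sandwich[OF always_eventually[OF allI[OF prod01(1)]] le tendsto_const])
      from tendsto_diff[OF tendsto_const[of 1] this] show ?thesis
        unfolding \<eta>_def diff_0_right .
    qed
  qed
qed

section \<open>Testing functions of zero trace with arbitrary smooth fields\<close>

lemma total_variation_ge:
  assumes "\<phi> \<in> test_fields \<Omega>" "\<And>x. norm (\<phi> x) \<le> 1"
  shows "ereal (- (LINT x|lebesgue_on \<Omega>. u x * divergence \<phi> x)) \<le> total_variation \<Omega> u"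
  unfolding total_variation_def using assms by (intro SUP_upper) auto

text \<open>If \<open>\<eta>\<^sub>n\<close> are smooth cutoffs of \<open>\<Omega>\<close>, the fields \<open>\<eta>\<^sub>n \<phi>\<close> are admissible in the definition of the total
variation. In terms of the gradient measure \<open>\<mu>\<close> and its direction \<open>\<sigma>\<close> they give
\<open>\<integral> \<eta>\<^sub>n \<phi> \<bullet> \<sigma> d\<mu>\<close>, which converges to \<open>\<integral> \<phi> \<bullet> \<sigma> d\<mu>\<close>; by the Gauss-Green formula with zero trace the limit is
\<open>- \<integral> u div \<phi>\<close>. No derivative of the cutoffs has to be controlled.\<close>

lemma total_variation_ge_of_zero_trace:
  assumes "open \<Omega>" and u: "has_trace \<Omega> u (\<lambda>_. 0)"
    and \<phi>: "\<And>k. Ck k \<phi>" "\<And>x. norm (\<phi> x) \<le> 1"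
  shows "ereal (- (LINT x|lebesgue_on \<Omega>. u x * divergence \<phi> x)) \<le> total_variation \<Omega> u"
proof -
  obtain \<mu> \<sigma> where grad: "is_gradient_measure \<Omega> u \<mu> \<sigma>"
    and gg: "\<And>\<phi>. Ck 1 \<phi> \<Longrightarrow> (LINT x|lebesgue_on \<Omega>. u x * divergence \<phi> x) = - (LINT x|\<mu>. \<phi> x \<bullet> \<sigma> x)"
    using u unfolding has_trace_def by (auto simp: set_lebesgue_integral_def)
  have sets: "sets \<mu> = sets (restrict_space borel \<Omega>)" and fin: "finite_measure \<mu>"
    and \<sigma>: "\<sigma> \<in> borel_measurable \<mu>" "AE x in \<mu>. norm (\<sigma> x) = 1"
    and test: "\<And>\<phi>. \<phi> \<in> test_fields \<Omega> \<Longrightarrow> (LINT x|lebesgue_on \<Omega>. u x * divergence \<phi> x) = - (LINT x|\<mu>. \<phi> x \<bullet> \<sigma> x)"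
    using grad unfolding is_gradient_measure_def by auto
  have sp: "space \<mu> = \<Omega>"
    using sets_eq_imp_space_eq[OF sets] by (simp add: space_restrict_space)
  obtain \<eta> :: "nat \<Rightarrow> real^2 \<Rightarrow> real" where \<eta>:
    "\<And>n k. cont_diff k (\<eta> n)" "\<And>n x. 0 \<le> \<eta> n x" "\<And>n x. \<eta> n x \<le> 1"
    "\<And>n. compact (closure {x. \<eta> n x \<noteq> 0})" "\<And>n. closure {x. \<eta> n x \<noteq> 0} \<subseteq> \<Omega>"
    "\<And>x. x \<in> \<Omega> \<Longrightarrow> (\<lambda>n. \<eta> n x) \<longlonglongrightarrow> 1"
    using smooth_cutoffs[OF \<open>open \<Omega>\<close>] by blast
  have meas: "f \<in> borel_measurable \<mu>" if "continuous_on UNIV f" for f :: "real^2 \<Rightarrow> real^2"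
    using measurable_restrict_space1[OF borel_measurable_continuous_onI[OF that], of \<Omega>]
    unfolding measurable_cong_sets[OF sets refl] .
  have Ck': "Ck k (\<lambda>x. \<eta> n x *\<^sub>R \<phi> x)" for n k
    using \<phi>(1) \<eta>(1) by (auto simp: Ck_eq_cont_diff intro: cont_diff_scaleR)
  have tf: "(\<lambda>x. \<eta> n x *\<^sub>R \<phi> x) \<in> test_fields \<Omega>" for n
  proof -
    have sub: "closure {x. \<eta> n x *\<^sub>R \<phi> x \<noteq> 0} \<subseteq> closure {x. \<eta> n x \<noteq> 0}"
      by (intro closure_mono) auto
    then have "compact (closure {x. \<eta> n x *\<^sub>R \<phi> x \<noteq> 0})"
      using \<eta>(4)[of n] by (meson bounded_subset closed_closure compact_eq_bounded_closed)
    with sub \<eta>(5)[of n] Ck' show ?thesis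
      unfolding test_fields_def by blast
  qed
  have nrm: "norm (\<eta> n x *\<^sub>R \<phi> x) \<le> 1" for n x
    using \<phi>(2)[of x] \<eta>(2,3)[of n x] by (simp add: mult_le_one)
  have "ereal (LINT x|\<mu>. (\<eta> n x *\<^sub>R \<phi> x) \<bullet> \<sigma> x) \<le> total_variation \<Omega> u" for n
    using total_variation_ge[OF tf[of n] nrm, of u] test[OF tf[of n]] by simp
  moreover have "(\<lambda>n. LINT x|\<mu>. (\<eta> n x *\<^sub>R \<phi> x) \<bullet> \<sigma> x) \<longlonglongrightarrow> (LINT x|\<mu>. \<phi> x \<bullet> \<sigma> x)"
  proof (rule integral_dominated_convergence[where w = "\<lambda>_. 1"])
    show "(\<lambda>x. \<phi> x \<bullet> \<sigma> x) \<in> borel_measurable \<mu>"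
      using \<phi>(1)[of 0] by (intro borel_measurable_inner \<sigma> meas) auto
    show "(\<lambda>x. (\<eta> n x *\<^sub>R \<phi> x) \<bullet> \<sigma> x) \<in> borel_measurable \<mu>" for n
      using Ck'[of 0 n] by (intro borel_measurable_inner \<sigma> meas) auto
    show "integrable \<mu> (\<lambda>_. 1::real)"
      using fin by (simp add: finite_measure.integrable_const)
    show "AE x in \<mu>. (\<lambda>n. (\<eta> n x *\<^sub>R \<phi> x) \<bullet> \<sigma> x) \<longlonglongrightarrow> \<phi> x \<bullet> \<sigma> x"
    proof (rule AE_I2)
      fix x assume "x \<in> space \<mu>"
      then have "(\<lambda>n. (\<eta> n x *\<^sub>R \<phi> x) \<bullet> \<sigma> x) \<longlonglongrightarrow> (1 *\<^sub>R \<phi> x) \<bullet> \<sigma> x"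
        using \<eta>(6) sp by (intro tendsto_intros) auto
      then show "(\<lambda>n. (\<eta> n x *\<^sub>R \<phi> x) \<bullet> \<sigma> x) \<longlonglongrightarrow> \<phi> x \<bullet> \<sigma> x" by simp
    qed
    show "AE x in \<mu>. norm ((\<eta> n x *\<^sub>R \<phi> x) \<bullet> \<sigma> x) \<le> 1" for n
      using \<sigma>(2)
    proof eventually_elim
      case (elim x)
      show ?case
        using Cauchy_Schwarz_ineq2[of "\<eta> n x *\<^sub>R \<phi> x" "\<sigma> x"] nrm[of n x] elim by simp
    qed
  qed
  ultimately have "ereal (LINT x|\<mu>. \<phi> x \<bullet> \<sigma> x) \<le> total_variation \<Omega> u"
    by (intro LIMSEQ_le_const2[where X = "\<lambda>n. ereal (LINT x|\<mu>. (\<eta> n x *\<^sub>R \<phi> x) \<bullet> \<sigma> x)"]) auto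
  then show ?thesis
    using gg[OF \<phi>(1)] by simp
qed

lemma divergence_eq_partials:
  assumes "\<phi> differentiable (at x)"
    and "((\<lambda>s. \<phi> (x + s *\<^sub>R axis 1 1) $ 1) has_real_derivative d1) (at 0)"
    and "((\<lambda>s. \<phi> (x + s *\<^sub>R axis 2 1) $ 2) has_real_derivative d2) (at 0)"
  shows "divergence \<phi> x = d1 + d2"
proof -
  have "((\<lambda>s. \<phi> (x + s *\<^sub>R axis i 1) $ i) has_real_derivative frechet_derivative \<phi> (at x) (axis i 1) $ i) (at 0)" for i
  proof -
    have d: "(\<phi> has_derivative frechet_derivative \<phi> (at x)) (at (x + 0 *\<^sub>R axis i 1))"
      using assms(1) frechet_derivative_works by auto
    have "((\<lambda>s. \<phi> (x + s *\<^sub>R axis i 1)) has_derivative (\<lambda>s. frechet_derivative \<phi> (at x) (s *\<^sub>R axis i 1))) (at 0)"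
      by (rule has_derivative_compose[where f = "\<lambda>s. x + s *\<^sub>R axis i 1" and g = \<phi>])
        (auto intro!: derivative_eq_intros simp: d[simplified])
    then have "((\<lambda>s. \<phi> (x + s *\<^sub>R axis i 1) $ i) has_derivative (\<lambda>s. frechet_derivative \<phi> (at x) (s *\<^sub>R axis i 1) $ i)) (at 0)"
      by (rule bounded_linear.has_derivative[OF bounded_linear_vec_nth])
    moreover have "frechet_derivative \<phi> (at x) (s *\<^sub>R axis i 1) = s *\<^sub>R frechet_derivative \<phi> (at x) (axis i 1)" for s
      using assms(1) linear_frechet_derivative linear_scale by metis
    ultimately show ?thesis
      by (elim has_derivative_imp_has_field_derivative) simp
  qed
  from DERIV_unique[OF this assms(2)] DERIV_unique[OF this assms(3)]
  show ?thesis by (simp add: divergence_def sum_2)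
qed

section \<open>The calibrating fields\<close>

lemma vector_2_eq: "vector [a, b] = a *\<^sub>R axis 1 1 + b *\<^sub>R (axis 2 1 :: real^2)"
  by (simp add: vec_eq_iff forall_2 axis_def)

lemma norm_2: "norm (x :: real^2) = sqrt ((x $ 1)\<^sup>2 + (x $ 2)\<^sup>2)"
  by (simp add: norm_vec_def L2_set_def sum_2)

lemma cont_diff_vector_2:
  assumes "cont_diff k a" "cont_diff k b"
  shows "cont_diff k (\<lambda>x. vector [a x, b x] :: real^2)"
  unfolding vector_2_eq by (intro cont_diff_add cont_diff_scaleR cont_diff_const assms)

lemma cont_diff_component: "cont_diff k (\<lambda>x :: real^2. x $ i)"
  by (intro cont_diff_bounded_linear bounded_linear_vec_nth)

text \<open>The smooth function \<open>\<theta>\<close> used for folding the plane. Its derivative at \<open>s\<close> is \<open>s / soft_abs \<epsilon> s\<close>.\<close>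

definition soft_abs :: "real \<Rightarrow> real \<Rightarrow> real" where
  "soft_abs \<epsilon> s = sqrt (s\<^sup>2 + \<epsilon>\<^sup>2)"

text \<open>For \<open>\<epsilon> = 0\<close> this is, in units of \<open>r\<^sup>2\<close>, the squared distance of \<open>x\<close> to the nearer one of the two
centres, so that the value 1 describes the two circles; a positive \<open>\<epsilon>\<close> replaces \<open>|x\<^sub>1|\<close> by its
smooth version.\<close>

definition fold_sq_dist :: "real \<Rightarrow> real \<Rightarrow> real^2 \<Rightarrow> real" where
  "fold_sq_dist r \<epsilon> x = ((soft_abs \<epsilon> (x $ 1) - r)\<^sup>2 + (x $ 2)\<^sup>2) / r\<^sup>2"

text \<open>The field \<open>(F\<^sub>1(\<theta>(x\<^sub>1), x\<^sub>2), \<theta>'(x\<^sub>1) F\<^sub>2(\<theta>(x\<^sub>1), x\<^sub>2))\<close>, where \<open>F(y) = - (y - p) h(t) / r\<close> is a radial field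
around \<open>p = (r, 0)\<close> with \<open>t = |y - p|\<^sup>2 / r\<^sup>2\<close>. The profile \<open>h(t) = (1 + t\<^sup>N)\<close> to the power \<open>- 1 / N\<close>
tends to \<open>min 1 (1 / t)\<close> from below.\<close>

definition calibration :: "real \<Rightarrow> real \<Rightarrow> nat \<Rightarrow> real^2 \<Rightarrow> real^2" where
  "calibration r \<epsilon> N x =
     vector [- ((soft_abs \<epsilon> (x $ 1) - r) * (1 + fold_sq_dist r \<epsilon> x ^ N) powr (- 1 / N) / r),
             - (x $ 1 / soft_abs \<epsilon> (x $ 1) * (x $ 2 * (1 + fold_sq_dist r \<epsilon> x ^ N) powr (- 1 / N)) / r)]"

lemma soft_abs_pos: "\<epsilon> > 0 \<Longrightarrow> soft_abs \<epsilon> s > 0"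
  unfolding soft_abs_def by (simp add: add_nonneg_pos)

lemma soft_abs_ge: "\<bar>s\<bar> \<le> soft_abs \<epsilon> s"
  unfolding soft_abs_def by (simp add: real_le_rsqrt)

lemma soft_abs_slope_le: "\<epsilon> > 0 \<Longrightarrow> \<bar>s / soft_abs \<epsilon> s\<bar> \<le> 1"
  using soft_abs_pos[of \<epsilon> s] soft_abs_ge[of s \<epsilon>] by (simp add: field_simps)

lemma fold_sq_dist_nonneg: "fold_sq_dist r \<epsilon> x \<ge> 0"
  by (simp add: fold_sq_dist_def)

lemma smooth_calibration:
  assumes "\<epsilon> > 0"
  shows "Ck k (calibration r \<epsilon> N)"
proof -
  have pos: "(x $ 1)\<^sup>2 + \<epsilon>\<^sup>2 > 0" for x :: "real^2"
    using assms by (simp add: add_nonneg_pos)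
  have sa: "cont_diff k (\<lambda>x :: real^2. soft_abs \<epsilon> (x $ 1))"
    unfolding soft_abs_def powr_half_sqrt[symmetric, OF less_imp_le[OF pos]]
    by (intro cont_diff_powr pos cont_diff_add cont_diff_power cont_diff_component cont_diff_const)
  have inv: "x $ 1 / soft_abs \<epsilon> (x $ 1) = x $ 1 * soft_abs \<epsilon> (x $ 1) powr (-1)" for x :: "real^2"
    using soft_abs_pos[OF assms, of "x $ 1"] by (simp add: powr_minus divide_inverse)
  have sq: "cont_diff k (fold_sq_dist r \<epsilon>)"
    unfolding fold_sq_dist_def[abs_def] divide_inverse
    by (intro cont_diff_mult cont_diff_add cont_diff_power cont_diff_component cont_diff_const cont_diff_diff sa)
  have pos': "1 + fold_sq_dist r \<epsilon> x ^ N > 0" for x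
    using fold_sq_dist_nonneg by (simp add: add_pos_nonneg)
  have m: "cont_diff k (\<lambda>x. - f x)" if "cont_diff k f" for f :: "real^2 \<Rightarrow> real"
    using cont_diff_diff[OF cont_diff_const that, of 0] by simp
  show ?thesis
    unfolding Ck_eq_cont_diff calibration_def[abs_def] inv divide_inverse[of _ r]
    by (intro cont_diff_vector_2 m cont_diff_mult cont_diff_diff cont_diff_const sa cont_diff_powr pos'
        soft_abs_pos[OF assms] cont_diff_component cont_diff_add cont_diff_power sq)
qed

text \<open>With \<open>m = 1 / h(t)\<close> one has \<open>|F|\<^sup>2 = t / m\<^sup>2\<close>, and \<open>m\<close> is at least both 1 and \<open>t\<close>, hence \<open>m\<^sup>2 \<ge> t\<close>.
Folding multiplies the second component by a factor of modulus at most 1.\<close>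

lemma norm_calibration_le:
  assumes "r > 0" "\<epsilon> > 0" "N > 0"
  shows "norm (calibration r \<epsilon> N x) \<le> 1"
proof -
  define a b q T where "a = soft_abs \<epsilon> (x $ 1) - r" and "b = x $ 2" and "q = x $ 1 / soft_abs \<epsilon> (x $ 1)"
    and "T = fold_sq_dist r \<epsilon> x"
  define m where "m = (1 + T ^ N) powr (1 / N)"
  have T: "T \<ge> 0" "a\<^sup>2 + b\<^sup>2 = r\<^sup>2 * T"
    using assms by (auto simp: T_def fold_sq_dist_nonneg fold_sq_dist_def a_def b_def)
  have TN: "1 + T ^ N \<ge> 1" using T by simp
  have m1: "m \<ge> 1"
    unfolding m_def using TN by (intro ge_one_powr_ge_zero) auto
  have "T ^ N \<le> m ^ N"
  proof -
    have "m ^ N = 1 + T ^ N"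
      unfolding m_def using TN assms by (simp add: powr_power)
    then show ?thesis by simp
  qed
  then have "T \<le> m"
    using m1 assms by (simp add: power_mono_iff T(1))
  also have "m \<le> m * m" using m1 by simp
  finally have Tm: "T \<le> m\<^sup>2" by (simp add: power2_eq_square)
  have minv: "(1 + T ^ N) powr (- 1 / N) = 1 / m"
    unfolding m_def by (simp add: powr_minus_divide)
  have "calibration r \<epsilon> N x = vector [- (a / m / r), - (q * (b / m) / r)]"
    unfolding calibration_def minv[unfolded T_def] by (simp add: a_def b_def q_def)
  then have "(norm (calibration r \<epsilon> N x))\<^sup>2 = (a / m / r)\<^sup>2 + (q * (b / m) / r)\<^sup>2"
    by (simp add: norm_2)
  also have "\<dots> = (a\<^sup>2 + q\<^sup>2 * b\<^sup>2) / (m\<^sup>2 * r\<^sup>2)"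
    by (simp add: power_divide power_mult_distrib add_divide_distrib)
  also have "\<dots> \<le> (a\<^sup>2 + 1 * b\<^sup>2) / (m\<^sup>2 * r\<^sup>2)"
  proof -
    have "q\<^sup>2 \<le> 1"
      using soft_abs_slope_le[OF assms(2), of "x $ 1"] by (simp add: q_def abs_square_le_1)
    then show ?thesis
      by (intro divide_right_mono add_left_mono mult_right_mono) auto
  qed
  also have "\<dots> = T / m\<^sup>2"
    using T(2) assms by simp
  also have "\<dots> \<le> 1"
    using Tm m1 by (simp add: divide_le_eq_1)
  finally show ?thesis
    by (simp add: abs_square_le_1)
qed

text \<open>A radial field \<open>(y - p) h(t)\<close> in the plane has divergence \<open>2 (h(t) + t h'(t))\<close>. For the profile at hand this is
\<open>2 (1 + t\<^sup>N)\<close> to the power \<open>- 1 - 1 / N\<close>; folding contributes the factor \<open>\<theta>'(x\<^sub>1)\<close>.\<close>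

lemma divergence_calibration:
  assumes "r > 0" "\<epsilon> > 0" "N > 0"
  shows "divergence (calibration r \<epsilon> N) x =
    - (2 / r) * (x $ 1 / soft_abs \<epsilon> (x $ 1)) * (1 + fold_sq_dist r \<epsilon> x ^ N) powr (- 1 - 1 / N)"
proof -
  define a b q T where "a = soft_abs \<epsilon> (x $ 1) - r" and "b = x $ 2" and "q = x $ 1 / soft_abs \<epsilon> (x $ 1)"
    and "T = fold_sq_dist r \<epsilon> x"
  define P where "P = (1 + T ^ N) powr (- 1 - 1 / N)"
  have T: "T \<ge> 0" "T = (a\<^sup>2 + b\<^sup>2) / r\<^sup>2"
    using assms by (auto simp: T_def fold_sq_dist_nonneg fold_sq_dist_def a_def b_def)
  have TN: "1 + T ^ N > 0" using T by (simp add: add_pos_nonneg)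
  have A: "(1 + T ^ N) powr (- 1 / N) = (1 + T ^ N) * P"
  proof -
    have "(1 + T ^ N) powr (- 1 / N) = (1 + T ^ N) powr (1 + (- 1 - 1 / N))" by simp
    also have "\<dots> = (1 + T ^ N) * P" unfolding powr_add P_def using TN by simp
    finally show ?thesis .
  qed
  have power_chain: "((\<lambda>s. (1 + f s ^ N) powr (- 1 / N)) has_real_derivative - (T ^ (N - 1) * f' * P)) (at 0)"
    if "(f has_real_derivative f') (at 0)" "f 0 = T" for f f'
  proof -
    have 1: "((\<lambda>s. 1 + f s ^ N) has_real_derivative real N * T ^ (N - 1) * f') (at 0)"
      using that by (auto intro!: derivative_eq_intros)
    have 2: "((\<lambda>y. y powr (- 1 / N)) has_real_derivative - 1 / N * (1 + f 0 ^ N) powr (- 1 / N - 1)) (at (1 + f 0 ^ N))"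
      using TN that(2) by (intro has_real_derivative_powr) simp
    have e: "- 1 / real N - 1 = - 1 - 1 / N" by simp
    show ?thesis
      using DERIV_chain2[OF 2 1] assms(3) that(2) unfolding e
      by (simp add: P_def mult_ac)
  qed
  have sa: "((\<lambda>s. soft_abs \<epsilon> (x $ 1 + s) - r) has_real_derivative q) (at 0)"
  proof -
    have "(x $ 1)\<^sup>2 + \<epsilon>\<^sup>2 > 0" using assms by (simp add: add_nonneg_pos)
    then show ?thesis unfolding soft_abs_def q_def
      by (auto intro!: derivative_eq_intros simp: field_simps)
  qed
  have T1: "((\<lambda>s. fold_sq_dist r \<epsilon> (x + s *\<^sub>R axis 1 1)) has_real_derivative 2 * a * q / r\<^sup>2) (at 0)"
    using DERIV_cdivide[OF DERIV_add[OF DERIV_power[OF sa, of 2] DERIV_const[of "b\<^sup>2"]], of "r\<^sup>2"]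
    by (simp add: fold_sq_dist_def a_def b_def axis_def mult_ac)
  have T2: "((\<lambda>s. fold_sq_dist r \<epsilon> (x + s *\<^sub>R axis 2 1)) has_real_derivative 2 * b / r\<^sup>2) (at 0)"
  proof -
    have b': "((\<lambda>s. b + s) has_real_derivative 1) (at 0)"
      by (auto intro!: derivative_eq_intros)
    show ?thesis
      using DERIV_cdivide[OF DERIV_add[OF DERIV_const[of "a\<^sup>2"] DERIV_power[OF b', of 2]], of "r\<^sup>2"]
      by (simp add: fold_sq_dist_def a_def b_def axis_def mult_ac)
  qed
  have N: "T ^ N = T ^ (N - 1) * T" using assms(3) by (simp add: power_eq_if)
  have "((\<lambda>s. calibration r \<epsilon> N (x + s *\<^sub>R axis 1 1) $ 1) has_real_derivative
      - ((q * ((1 + T ^ N) * P) + - (T ^ (N - 1) * (2 * a * q / r\<^sup>2) * P) * a) / r)) (at 0)"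
  proof -
    have "((\<lambda>s. - ((soft_abs \<epsilon> (x $ 1 + s) - r) * (1 + fold_sq_dist r \<epsilon> (x + s *\<^sub>R axis 1 1) ^ N) powr (- 1 / N) / r))
      has_real_derivative - ((q * (1 + T ^ N) powr (- 1 / N) + - (T ^ (N - 1) * (2 * a * q / r\<^sup>2) * P) * a) / r)) (at 0)"
      using DERIV_minus[OF DERIV_cdivide[OF DERIV_mult[OF sa power_chain[OF T1]], of r]]
      by (simp add: a_def T_def)
    then show ?thesis unfolding A by (simp add: calibration_def axis_def)
  qed
  moreover have "((\<lambda>s. calibration r \<epsilon> N (x + s *\<^sub>R axis 2 1) $ 2) has_real_derivative
      - (q * (1 * ((1 + T ^ N) * P) + - (T ^ (N - 1) * (2 * b / r\<^sup>2) * P) * b) / r)) (at 0)"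
  proof -
    have b': "((\<lambda>s. b + s) has_real_derivative 1) (at 0)"
      by (auto intro!: derivative_eq_intros)
    have "((\<lambda>s. - (q * ((b + s) * (1 + fold_sq_dist r \<epsilon> (x + s *\<^sub>R axis 2 1) ^ N) powr (- 1 / N)) / r))
      has_real_derivative - (q * (1 * (1 + T ^ N) powr (- 1 / N) + - (T ^ (N - 1) * (2 * b / r\<^sup>2) * P) * b) / r)) (at 0)"
      using DERIV_minus[OF DERIV_cdivide[OF DERIV_cmult[OF DERIV_mult[OF b' power_chain[OF T2]], of q], of r]]
      by (simp add: T_def)
    then show ?thesis unfolding A by (simp add: calibration_def axis_def q_def b_def)
  qed
  moreover have "calibration r \<epsilon> N differentiable (at x)"
    using smooth_calibration[OF assms(2), of "Suc 0" r N] by auto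
  ultimately have "divergence (calibration r \<epsilon> N) x =
      - ((q * ((1 + T ^ N) * P) + - (T ^ (N - 1) * (2 * a * q / r\<^sup>2) * P) * a) / r)
      + - (q * (1 * ((1 + T ^ N) * P) + - (T ^ (N - 1) * (2 * b / r\<^sup>2) * P) * b) / r)"
    by (intro divergence_eq_partials)
  also have "\<dots> = - (2 * q * P / r) * (1 + T ^ N - T ^ (N - 1) * ((a\<^sup>2 + b\<^sup>2) / r\<^sup>2))"
    by (simp add: diff_divide_distrib add_divide_distrib power2_eq_square algebra_simps)
  also have "\<dots> = - (2 / r) * q * P"
    unfolding T(2)[symmetric] N[symmetric] by simp
  finally show ?thesis
    by (simp add: q_def P_def T_def)
qed

text \<open>The datum \<open>g\<close> of the minimization problem.\<close>

definition signed_balls :: "real \<Rightarrow> real^2 \<Rightarrow> real" where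
  "signed_balls r x = indicator (ball (vector [r, 0]) r) x - indicator (ball (vector [- r, 0]) r) x"

lemma mem_ball_2:
  fixes x :: "real^2"
  assumes "r > 0"
  shows "x \<in> ball (vector [a, b]) r \<longleftrightarrow> (x $ 1 - a)\<^sup>2 + (x $ 2 - b)\<^sup>2 < r\<^sup>2"
proof -
  have "x \<in> ball (vector [a, b]) r \<longleftrightarrow> sqrt ((x $ 1 - a)\<^sup>2 + (x $ 2 - b)\<^sup>2) < r"
    by (simp add: dist_norm norm_2 power2_commute)
  also have "\<dots> \<longleftrightarrow> (x $ 1 - a)\<^sup>2 + (x $ 2 - b)\<^sup>2 < r\<^sup>2"
    using assms real_sqrt_less_iff[of "(x $ 1 - a)\<^sup>2 + (x $ 2 - b)\<^sup>2" "r\<^sup>2"] by simp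
  finally show ?thesis .
qed

text \<open>The two discs lie in the open half-planes \<open>x\<^sub>1 > 0\<close> and \<open>x\<^sub>1 < 0\<close> and are mirror images of each other,
so folding the plane identifies them.\<close>

lemma signed_balls_eq:
  assumes "r > 0"
  shows "signed_balls r x = (if fold_sq_dist r 0 x < 1 then sgn (x $ 1) else 0)"
proof -
  have iff: "x \<in> ball (vector [s, 0]) r \<longleftrightarrow> (x $ 1 - s)\<^sup>2 + (x $ 2)\<^sup>2 < r\<^sup>2" for s
    using mem_ball_2[OF assms, of x s 0] by simp
  have pos: "0 < x $ 1" if "(x $ 1 - r)\<^sup>2 + (x $ 2)\<^sup>2 < r\<^sup>2"
  proof (rule ccontr)
    assume "\<not> 0 < x $ 1"
    then have "r\<^sup>2 \<le> (r - x $ 1)\<^sup>2" using assms by (intro power_mono) auto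
    then show False using that zero_le_power2[of "x $ 2"] by (simp add: power2_commute)
  qed
  have neg: "x $ 1 < 0" if "(x $ 1 - - r)\<^sup>2 + (x $ 2)\<^sup>2 < r\<^sup>2"
  proof (rule ccontr)
    assume "\<not> x $ 1 < 0"
    then have "r\<^sup>2 \<le> (x $ 1 - - r)\<^sup>2" using assms by (intro power_mono) auto
    then show False using that zero_le_power2[of "x $ 2"] by simp
  qed
  have sq: "fold_sq_dist r 0 x < 1 \<longleftrightarrow> (\<bar>x $ 1\<bar> - r)\<^sup>2 + (x $ 2)\<^sup>2 < r\<^sup>2"
    using assms by (simp add: fold_sq_dist_def soft_abs_def)
  consider "x $ 1 > 0" | "x $ 1 < 0" | "x $ 1 = 0" by linarith
  then show ?thesis
  proof cases
    case 1
    then have "x \<notin> ball (vector [- r, 0]) r" using neg iff[of "- r"] by auto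
    then show ?thesis using 1 iff[of r] sq by (simp add: signed_balls_def)
  next
    case 2
    have "(\<bar>x $ 1\<bar> - r)\<^sup>2 = (x $ 1 - - r)\<^sup>2" using 2 by (simp add: power2_eq_square algebra_simps)
    moreover have "x \<notin> ball (vector [r, 0]) r" using 2 pos iff[of r] by auto
    ultimately show ?thesis using 2 iff[of "- r"] sq by (simp add: signed_balls_def)
  next
    case 3
    then have "x \<notin> ball (vector [r, 0]) r" "x \<notin> ball (vector [- r, 0]) r"
      using pos neg iff[of r] iff[of "- r"] by auto
    then show ?thesis using 3 by (simp add: signed_balls_def)
  qed
qed

lemma tendsto_fold_sq_dist:
  assumes "r > 0" "\<epsilon> \<longlonglongrightarrow> 0"
  shows "(\<lambda>n. fold_sq_dist r (\<epsilon> n) x) \<longlonglongrightarrow> fold_sq_dist r 0 x"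
  unfolding fold_sq_dist_def soft_abs_def using assms by (intro tendsto_intros) auto

text \<open>The limit of the divergences of the radial fields: \<open>l < 1\<close> is the inside of the disc and \<open>l > 1\<close> the outside.\<close>

lemma one_plus_power_powr_tendsto:
  fixes t :: "nat \<Rightarrow> real"
  assumes "t \<longlonglongrightarrow> l" "\<And>n. t n \<ge> 0" "l \<noteq> 1"
  shows "(\<lambda>n. (1 + t n ^ Suc n) powr (- 1 - 1 / Suc n)) \<longlonglongrightarrow> (if l < 1 then 1 else 0)"
proof (cases "l < 1")
  case True
  then obtain q where q: "l < q" "q < 1" using dense by blast
  have l0: "l \<ge> 0" using assms(1,2) by (intro LIMSEQ_le_const) auto
  have "(\<lambda>n. t n ^ Suc n) \<longlonglongrightarrow> 0"
  proof (rule tendsto_sandwich[of "\<lambda>_. 0" _ _ "\<lambda>n. q ^ Suc n"])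
    show "(\<lambda>n. q ^ Suc n) \<longlonglongrightarrow> 0"
      using q l0 by (intro LIMSEQ_Suc LIMSEQ_power_zero) auto
    show "\<forall>\<^sub>F n in sequentially. t n ^ Suc n \<le> q ^ Suc n"
      using order_tendstoD(2)[OF assms(1) q(1)]
      by eventually_elim (intro power_mono, use assms(2) in auto)
  qed (use assms(2) in auto)
  from tendsto_add[OF tendsto_const this, of 1] have "(\<lambda>n. 1 + t n ^ Suc n) \<longlonglongrightarrow> 1" by simp
  moreover have "(\<lambda>n. - 1 - 1 / real (Suc n)) \<longlonglongrightarrow> - 1 - 0"
    by (intro tendsto_intros LIMSEQ_Suc[OF lim_1_over_n])
  ultimately have "(\<lambda>n. (1 + t n ^ Suc n) powr (- 1 - 1 / Suc n)) \<longlonglongrightarrow> 1 powr (- 1 - 0)"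
    by (intro tendsto_powr) auto
  with True show ?thesis by simp
next
  case False
  with assms(3) obtain q where q: "1 < q" "q < l" using dense[of 1 l] by auto
  have "(\<lambda>n. (1 + t n ^ Suc n) powr (- 1 - 1 / Suc n)) \<longlonglongrightarrow> 0"
  proof (rule tendsto_sandwich[of "\<lambda>_. 0" _ _ "\<lambda>n. (inverse q) ^ Suc n"])
    show "(\<lambda>n. inverse q ^ Suc n) \<longlonglongrightarrow> 0"
      using q by (intro LIMSEQ_Suc LIMSEQ_power_zero) (auto simp: inverse_less_1_iff)
    show "\<forall>\<^sub>F n in sequentially. (1 + t n ^ Suc n) powr (- 1 - 1 / Suc n) \<le> inverse q ^ Suc n"
      using order_tendstoD(1)[OF assms(1) q(2)]
    proof eventually_elim
      case (elim n)
      have q': "q ^ Suc n > 0" "t n ^ Suc n \<ge> 0" using q assms(2) by auto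
      have "q ^ Suc n \<le> t n ^ Suc n" using elim q by (intro power_mono) auto
      then have 1: "q ^ Suc n \<le> 1 + t n ^ Suc n" by simp
      have "(1 + t n ^ Suc n) powr (- 1 - 1 / Suc n) \<le> (1 + t n ^ Suc n) powr (- 1)"
        using q'(2) by (intro powr_mono) auto
      also have "\<dots> = inverse (1 + t n ^ Suc n)"
        using q'(2) by (simp add: powr_minus)
      also have "\<dots> \<le> inverse (q ^ Suc n)"
        using 1 q'(1) by (rule le_imp_inverse_le)
      finally show ?case by (simp only: power_inverse)
    qed
  qed auto
  with False show ?thesis by simp
qed

lemma divergence_calibration_le:
  assumes "r > 0" "\<epsilon> > 0" "N > 0"
  shows "\<bar>divergence (calibration r \<epsilon> N) x\<bar> \<le> 2 / r"
proof -
  have "1 + fold_sq_dist r \<epsilon> x ^ N \<ge> 1" using fold_sq_dist_nonneg by simp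
  then have "(1 + fold_sq_dist r \<epsilon> x ^ N) powr (- 1 - 1 / N) \<le> (1 + fold_sq_dist r \<epsilon> x ^ N) powr 0"
    using zero_le_divide_1_iff[of "real N"] by (intro powr_mono) linarith+
  also have "\<dots> = 1" using \<open>1 + fold_sq_dist r \<epsilon> x ^ N \<ge> 1\<close> by simp
  finally have P: "\<bar>(1 + fold_sq_dist r \<epsilon> x ^ N) powr (- 1 - 1 / N)\<bar> \<le> 1" by simp
  have "\<bar>divergence (calibration r \<epsilon> N) x\<bar> =
      2 / r * (\<bar>x $ 1 / soft_abs \<epsilon> (x $ 1)\<bar> * \<bar>(1 + fold_sq_dist r \<epsilon> x ^ N) powr (- 1 - 1 / N)\<bar>)"
    unfolding divergence_calibration[OF assms] using assms(1) by (simp add: abs_mult)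
  also have "\<dots> \<le> 2 / r * 1"
    using soft_abs_slope_le[OF assms(2), of "x $ 1"] P assms(1)
    by (intro mult_left_mono mult_le_one) auto
  finally show ?thesis by simp
qed

lemma tendsto_divergence_calibration:
  assumes "r > 0" "fold_sq_dist r 0 x \<noteq> 1"
  shows "(\<lambda>n. divergence (calibration r (1 / Suc n) (Suc n)) x) \<longlonglongrightarrow> - (2 / r) * signed_balls r x"
proof -
  have e: "(\<lambda>n. 1 / real (Suc n)) \<longlonglongrightarrow> 0" by (rule LIMSEQ_Suc[OF lim_1_over_n])
  have slope: "(\<lambda>n. x $ 1 / soft_abs (1 / Suc n) (x $ 1)) \<longlonglongrightarrow> sgn (x $ 1)"
  proof (cases "x $ 1 = 0")
    case False
    have "(\<lambda>n. x $ 1 / soft_abs (1 / Suc n) (x $ 1)) \<longlonglongrightarrow> x $ 1 / sqrt ((x $ 1)\<^sup>2 + 0\<^sup>2)"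
      unfolding soft_abs_def using False by (intro tendsto_intros e) auto
    then show ?thesis by (simp add: sgn_real_def abs_if split: if_splits)
  qed simp
  have "(\<lambda>n. - (2 / r) * (x $ 1 / soft_abs (1 / Suc n) (x $ 1)) *
      (1 + fold_sq_dist r (1 / Suc n) x ^ Suc n) powr (- 1 - 1 / Suc n))
      \<longlonglongrightarrow> - (2 / r) * sgn (x $ 1) * (if fold_sq_dist r 0 x < 1 then 1 else 0)"
    by (intro tendsto_mult tendsto_const slope one_plus_power_powr_tendsto tendsto_fold_sq_dist e assms fold_sq_dist_nonneg)
  moreover have "- (2 / r) * sgn (x $ 1) * (if fold_sq_dist r 0 x < 1 then 1 else 0) = - (2 / r) * signed_balls r x"
    unfolding signed_balls_eq[OF assms(1)] by simp
  moreover have "divergence (calibration r (1 / Suc n) (Suc n)) x = - (2 / r) * (x $ 1 / soft_abs (1 / Suc n) (x $ 1)) *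
      (1 + fold_sq_dist r (1 / Suc n) x ^ Suc n) powr (- 1 - 1 / Suc n)" for n
    using assms(1) by (intro divergence_calibration) auto
  ultimately show ?thesis by (simp only:)
qed

lemma continuous_on_divergence:
  assumes "Ck 1 \<phi>"
  shows "continuous_on UNIV (divergence \<phi>)"
  using assms unfolding divergence_def[abs_def] by (auto intro!: continuous_intros)

text \<open>Test \<open>u\<close> with the calibrating fields and let \<open>\<epsilon> = 1 / N\<close> tend to 0: their divergences converge off the two
circles, which are null sets, and are dominated by \<open>2 / r\<close>.\<close>

lemma total_variation_ge_signed_balls:
  assumes "open \<Omega>" "r > 0" and u: "has_trace \<Omega> u (\<lambda>_. 0)"
  shows "ereal (2 / r * (LINT x|lebesgue_on \<Omega>. u x * signed_balls r x)) \<le> total_variation \<Omega> u"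
proof -
  define z where "z n = calibration r (1 / Suc n) (Suc n)" for n
  have int: "integrable (lebesgue_on \<Omega>) u"
    using u by (simp add: has_trace_def BV_def)
  have \<Omega>: "\<Omega> \<in> sets lebesgue" using \<open>open \<Omega>\<close> by (simp add: lmeasurable_iff_integrable borel_open)
  have ge: "ereal (- (LINT x|lebesgue_on \<Omega>. u x * divergence (z n) x)) \<le> total_variation \<Omega> u" for n
    unfolding z_def using assms(2)
    by (intro total_variation_ge_of_zero_trace[OF assms(1) u] smooth_calibration norm_calibration_le) auto
  have "(\<lambda>n. LINT x|lebesgue_on \<Omega>. u x * divergence (z n) x)
      \<longlonglongrightarrow> (LINT x|lebesgue_on \<Omega>. u x * (- (2 / r) * signed_balls r x))"
  proof (rule integral_dominated_convergence[where w = "\<lambda>x. 2 / r * norm (u x)"])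
    have um: "u \<in> borel_measurable (lebesgue_on \<Omega>)" using int by auto
    have "divergence (z n) \<in> borel_measurable (lebesgue_on \<Omega>)" for n
    proof -
      have "Ck 1 (z n)" unfolding z_def by (rule smooth_calibration) simp
      then have "divergence (z n) \<in> borel_measurable borel"
        by (intro borel_measurable_continuous_onI continuous_on_divergence)
      then show ?thesis
        by (intro measurable_restrict_space1 measurable_completion) simp
    qed
    with um show "(\<lambda>x. u x * divergence (z n) x) \<in> borel_measurable (lebesgue_on \<Omega>)" for n
      by measurable
    have "signed_balls r \<in> borel_measurable borel"
      unfolding signed_balls_def[abs_def] by (intro borel_measurable_diff borel_measurable_indicator) auto
    then have "signed_balls r \<in> borel_measurable (lebesgue_on \<Omega>)"
      by (intro measurable_restrict_space1 measurable_completion) simp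
    with um show "(\<lambda>x. u x * (- (2 / r) * signed_balls r x)) \<in> borel_measurable (lebesgue_on \<Omega>)"
      by measurable
    show "integrable (lebesgue_on \<Omega>) (\<lambda>x. 2 / r * norm (u x))"
      using int by (intro integrable_mult_right integrable_norm)
    show "AE x in lebesgue_on \<Omega>. norm (u x * divergence (z n) x) \<le> 2 / r * norm (u x)" for n
    proof (rule AE_I2)
      fix x
      have "\<bar>divergence (z n) x\<bar> \<le> 2 / r"
        unfolding z_def using assms(2) by (intro divergence_calibration_le) auto
      then have "norm (u x) * \<bar>divergence (z n) x\<bar> \<le> norm (u x) * (2 / r)"
        by (intro mult_left_mono) auto
      then show "norm (u x * divergence (z n) x) \<le> 2 / r * norm (u x)"
        by (simp add: abs_mult mult.commute)
    qed
    have "{x :: real^2. fold_sq_dist r 0 x = 1} \<subseteq> sphere (vector [r, 0]) r \<union> sphere (vector [- r, 0]) r"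
    proof
      fix x :: "real^2" assume "x \<in> {x. fold_sq_dist r 0 x = 1}"
      then have *: "(\<bar>x $ 1\<bar> - r)\<^sup>2 + (x $ 2)\<^sup>2 = r\<^sup>2"
        using assms(2) by (simp add: fold_sq_dist_def soft_abs_def)
      have sph: "x \<in> sphere (vector [a, 0]) r \<longleftrightarrow> sqrt ((x $ 1 - a)\<^sup>2 + (x $ 2)\<^sup>2) = r" for a
        by (simp add: dist_norm norm_2 power2_commute)
      have "(\<bar>x $ 1\<bar> - r)\<^sup>2 = (x $ 1 - r)\<^sup>2 \<or> (\<bar>x $ 1\<bar> - r)\<^sup>2 = (x $ 1 - - r)\<^sup>2"
        by (cases "x $ 1 \<ge> 0") (auto simp: power2_eq_square algebra_simps)
      with * sph[of r] sph[of "- r"] assms(2) show "x \<in> sphere (vector [r, 0]) r \<union> sphere (vector [- r, 0]) r"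
        by auto
    qed
    then have "negligible {x :: real^2. fold_sq_dist r 0 x = 1}"
      by (rule negligible_subset[rotated]) (intro negligible_Un negligible_sphere)
    then have "AE x in lebesgue. fold_sq_dist r 0 (x :: real^2) \<noteq> 1"
      by (intro AE_I'[of "{x. fold_sq_dist r 0 x = 1}"]) (auto simp: negligible_iff_null_sets)
    then have "AE x in lebesgue_on \<Omega>. fold_sq_dist r 0 (x :: real^2) \<noteq> 1"
      using \<Omega> by (subst AE_restrict_space_iff) auto
    then show "AE x in lebesgue_on \<Omega>. (\<lambda>n. u x * divergence (z n) x) \<longlonglongrightarrow> u x * (- (2 / r) * signed_balls r x)"
    proof eventually_elim
      case (elim x)
      then show ?case unfolding z_def
        by (intro tendsto_mult tendsto_const tendsto_divergence_calibration assms)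
    qed
  qed
  then have "(\<lambda>n. ereal (- (LINT x|lebesgue_on \<Omega>. u x * divergence (z n) x)))
      \<longlonglongrightarrow> ereal (- (LINT x|lebesgue_on \<Omega>. u x * (- (2 / r) * signed_balls r x)))"
    by (intro tendsto_intros)
  then have "ereal (- (LINT x|lebesgue_on \<Omega>. u x * (- (2 / r) * signed_balls r x))) \<le> total_variation \<Omega> u"
    by (rule LIMSEQ_le_const2) (use ge in blast)
  moreover have "- (LINT x|lebesgue_on \<Omega>. u x * (- (2 / r) * signed_balls r x)) =
      2 / r * (LINT x|lebesgue_on \<Omega>. u x * signed_balls r x)"
    unfolding integral_mult_right_zero[symmetric] integral_minus[symmetric] by (simp add: mult_ac)
  ultimately show ?thesis by (simp only:)
qed

section \<open>The divergence theorem on a disc\<close>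

definition circle_dir :: "real \<Rightarrow> real^2" where
  "circle_dir t = vector [cos t, sin t]"

definition circle_tan :: "real \<Rightarrow> real^2" where
  "circle_tan t = vector [- sin t, cos t]"

lemma circle_dir_has_vector_derivative:
  "(circle_dir has_vector_derivative circle_tan t) (at t within S)"
  unfolding circle_dir_def[abs_def] circle_tan_def vector_2_eq
  by (auto intro!: derivative_eq_intros)

lemma circle_tan_has_vector_derivative:
  "(circle_tan has_vector_derivative - circle_dir t) (at t within S)"
  unfolding circle_tan_def[abs_def] circle_dir_def vector_2_eq
  by (auto intro!: derivative_eq_intros simp: algebra_simps)

lemma norm_circle_dir [simp]: "norm (circle_dir t) = 1"
  by (simp add: norm_2 circle_dir_def)

text \<open>The change of variables formula lives on \<open>real^2\<close>, iterated integrals on \<open>real \<times> real\<close>; this lemma passes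
from one to the other.\<close>

lemma has_integral_pair_of_vector:
  fixes f :: "real^2 \<Rightarrow> real"
  assumes "(f has_integral i) (cbox a b)"
  shows "((\<lambda>(x, y). f (vector [x, y])) has_integral i) (cbox (a $ 1, a $ 2) (b $ 1, b $ 2))"
proof -
  define G where "G p = (vector [fst p, snd p] :: real^2)" for p :: "real \<times> real"
  define H where "H x = (x $ 1, x $ 2)" for x :: "real^2"
  have HG: "H (G p) = p" for p by (simp add: H_def G_def)
  have GH: "G (H x) = x" for x by (simp add: H_def G_def vec_eq_iff forall_2)
  have Gbox: "G ` cbox u v = cbox (G u) (G v)" for u v
  proof -
    have "G ` cbox u v = H -` cbox u v"
      using HG GH by (auto intro: image_eqI[of _ G, OF GH[symmetric]])
    also have "\<dots> = cbox (G u) (G v)"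
      by (cases u; cases v) (auto simp: H_def G_def mem_box_cart forall_2 cbox_Pair_eq)
    finally show ?thesis .
  qed
  have Hbox: "H ` cbox u v = cbox (H u) (H v)" for u v
    using Gbox[of "H u" "H v"] by (force simp: GH HG image_iff)
  have content: "measure lborel (G ` cbox u v) = 1 * measure lborel (cbox u v)" for u v
  proof (cases "cbox u v = {}")
    case False
    then have "cbox (G u) (G v) \<noteq> {}" using Gbox[of u v] by auto
    moreover have "fst u \<le> fst v" "snd u \<le> snd v"
      using False by (cases u; cases v; auto simp: cbox_Pair_eq)+
    ultimately show ?thesis
      unfolding Gbox by (cases u; cases v) (simp add: content_cbox_cart content_Pair G_def UNIV_2)
  qed simp
  have "((\<lambda>x. f (G x)) has_integral (1 / 1) *\<^sub>R i) (H ` cbox a b)"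
  proof (rule has_integral_twiddle[OF _ HG GH _ _ _ content assms])
    have "continuous_on UNIV G"
      unfolding G_def vector_2_eq by (intro continuous_intros)
    then show "isCont G x" for x by (cases x) (simp add: continuous_on_eq_continuous_at)
    show "\<exists>w z. G ` cbox u v = cbox w z" for u v using Gbox by blast
    show "\<exists>w z. H ` cbox u v = cbox w z" for u v using Hbox by blast
  qed simp
  then show ?thesis
    unfolding Hbox by (simp add: G_def H_def case_prod_beta')
qed

definition polar :: "real^2 \<Rightarrow> real^2 \<Rightarrow> real^2" where
  "polar c x = c + x $ 1 *\<^sub>R circle_dir (x $ 2)"

lemma inj_on_polar: "inj_on (polar c) (box 0 (vector [r, 2 * pi]))"
proof (rule inj_onI)
  fix x y assume x: "x \<in> box 0 (vector [r, 2 * pi])" and y: "y \<in> box 0 (vector [r, 2 * pi])"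
    and "polar c x = polar c y"
  then have eq: "x $ 1 *\<^sub>R circle_dir (x $ 2) = y $ 1 *\<^sub>R circle_dir (y $ 2)"
    by (simp add: polar_def)
  have pos: "0 < x $ 1" "0 < y $ 1" "0 < x $ 2" "0 < y $ 2" "x $ 2 < 2 * pi" "y $ 2 < 2 * pi"
    using x y by (auto simp: mem_box_cart forall_2)
  have 1: "x $ 1 = y $ 1"
    using arg_cong[OF eq, of norm] pos by simp
  then have "circle_dir (x $ 2) = circle_dir (y $ 2)"
    using eq pos by simp
  then have "sin (x $ 2) = sin (y $ 2) \<and> cos (x $ 2) = cos (y $ 2)"
    by (simp add: circle_dir_def vec_eq_iff forall_2)
  then obtain n :: int where n: "x $ 2 = y $ 2 + 2 * pi * n"
    using sin_cos_eq_iff by blast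
  then have "2 * pi * n < 2 * pi * 1" "2 * pi * (-1) < 2 * pi * n"
    using pos by linarith+
  then have "real_of_int n < 1" "-1 < real_of_int n"
    by (simp_all only: mult_less_cancel_left_pos[OF mult_pos_pos[OF zero_less_numeral pi_gt_zero]])
  then have "n = 0" by linarith
  with n 1 show "x = y" by (simp add: vec_eq_iff forall_2)
qed

lemma polar_image_subset: "polar c ` box 0 (vector [r, 2 * pi]) \<subseteq> ball c r"
  by (auto simp: polar_def mem_box_cart forall_2 dist_norm)

text \<open>With angles in the open interval from 0 to \<open>2 \<pi>\<close>, polar coordinates miss only points on the horizontal
line through the centre, which form a null set.\<close>

lemma ball_diff_polar_image:
  "ball c r - polar c ` box 0 (vector [r, 2 * pi]) \<subseteq> {y. axis 2 1 \<bullet> y = c $ 2}"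
proof
  fix y assume y: "y \<in> ball c r - polar c ` box 0 (vector [r, 2 * pi])"
  show "y \<in> {y. axis 2 1 \<bullet> y = c $ 2}"
  proof (rule ccontr)
    assume "y \<notin> {y. axis 2 1 \<bullet> y = c $ 2}"
    then have ne: "y $ 2 \<noteq> c $ 2" by (simp add: inner_axis')
    define d where "d = y - c"
    have d: "d $ 2 \<noteq> 0" "norm d > 0" "norm d < r"
      using ne y by (auto simp: d_def dist_norm norm_minus_commute)
    have "(d $ 1 / norm d)\<^sup>2 + (d $ 2 / norm d)\<^sup>2 = 1"
      using d norm_2[of d] by (simp add: power_divide flip: add_divide_distrib)
    then obtain t where t: "0 \<le> t" "t < 2 * pi" "d $ 1 / norm d = cos t" "d $ 2 / norm d = sin t"
      by (rule sincos_total_2pi)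
    have "t \<noteq> 0" using t(4) d by auto
    have "y = polar c (vector [norm d, t])"
      using t(3,4)[symmetric] d by (simp add: polar_def circle_dir_def vec_eq_iff forall_2 d_def)
    moreover have "vector [norm d, t] \<in> box 0 (vector [r, 2 * pi] :: real^2)"
      using t d \<open>t \<noteq> 0\<close> by (simp add: mem_box_cart forall_2)
    ultimately show False using y by blast
  qed
qed

lemma integral_ball_polar:
  fixes h :: "real^2 \<Rightarrow> real"
  assumes h: "continuous_on UNIV h" and "r > 0"
  shows "integral (ball c r) h =
    integral (cbox (0, 0) (r, 2 * pi)) (\<lambda>(\<rho>, t). \<rho> * h (c + \<rho> *\<^sub>R circle_dir t))"
proof -
  define S where "S = box (0 :: real^2) (vector [r, 2 * pi])"
  define P' where "P' x v = v $ 1 *\<^sub>R circle_dir (x $ 2) + x $ 1 *\<^sub>R v $ 2 *\<^sub>R circle_tan (x $ 2)"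
    for x v :: "real^2"
  define F where "F x = x $ 1 * h (polar c x)" for x
  have der: "(polar c has_derivative P' x) (at x within S)" for x
  proof -
    have "((\<lambda>x :: real^2. x $ 2) has_derivative (\<lambda>v. v $ 2)) (at x within S)"
      by (intro bounded_linear_imp_has_derivative bounded_linear_vec_nth)
    from has_derivative_compose[OF this circle_dir_has_vector_derivative[unfolded has_vector_derivative_def, of _ UNIV]]
    have 1: "((\<lambda>x :: real^2. circle_dir (x $ 2)) has_derivative (\<lambda>v. v $ 2 *\<^sub>R circle_tan (x $ 2))) (at x within S)" .
    have 2: "((\<lambda>x :: real^2. x $ 1) has_derivative (\<lambda>v. v $ 1)) (at x within S)"
      by (intro bounded_linear_imp_has_derivative bounded_linear_vec_nth)
    show ?thesis
      unfolding polar_def[abs_def] P'_def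
      using has_derivative_add[OF has_derivative_const[of c] has_derivative_scaleR[OF 2 1]]
      by (simp add: add.commute)
  qed
  have det: "det (matrix (P' x)) = x $ 1" for x
    by (simp add: det_2 matrix_def P'_def circle_dir_def circle_tan_def axis_def
        mult.assoc[symmetric] flip: distrib_left power2_eq_square)
      (simp add: algebra_simps power2_eq_square[symmetric] flip: distrib_left)
  have contP: "continuous_on UNIV (polar c)"
    unfolding polar_def[abs_def] circle_dir_def vector_2_eq by (intro continuous_intros)
  have contF: "continuous_on UNIV F"
    unfolding F_def[abs_def]
    by (intro continuous_intros continuous_on_compose2[OF h contP]) auto
  \<comment> \<open>The change of variables formula is about vector-valued functions, hence the detour over \<open>real^1\<close>.\<close>
  define lift where "lift y = (vec y :: real^1)" for y :: real
  have contL: "continuous_on X (\<lambda>x. lift (f x))" if "continuous_on UNIV f" for f :: "real^2 \<Rightarrow> real" and X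
    unfolding lift_def vec_def by (intro continuous_on_vec_lambda continuous_on_subset[OF that]) auto
  have absF: "(\<lambda>x. \<bar>det (matrix (P' x))\<bar> *\<^sub>R lift (h (polar c x))) absolutely_integrable_on S"
  proof -
    have "(\<lambda>x. lift (F x)) absolutely_integrable_on cbox 0 (vector [r, 2 * pi])"
      by (intro absolutely_integrable_continuous contL contF)
    then have "(\<lambda>x. lift (F x)) absolutely_integrable_on S"
      unfolding S_def by (rule set_integrable_subset) (auto simp: box_subset_cbox)
    then show ?thesis
      by (rule absolutely_integrable_spike[where S = "{}"])
        (auto simp: det F_def lift_def vec_eq_iff S_def mem_box_cart forall_2)
  qed
  have cov: "(\<lambda>x. lift (h x)) absolutely_integrable_on polar c ` S \<and>
      integral (polar c ` S) (\<lambda>x. lift (h x)) = integral S (\<lambda>x. \<bar>det (matrix (P' x))\<bar> *\<^sub>R lift (h (polar c x)))"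
    using has_absolute_integral_change_of_variables[of S "polar c" P' "\<lambda>x. lift (h x)"
        "integral S (\<lambda>x. \<bar>det (matrix (P' x))\<bar> *\<^sub>R lift (h (polar c x)))", OF _ der]
      absF inj_on_polar[of c r]
    by (simp add: S_def)
  have "integral (ball c r) h = integral (polar c ` S) h"
  proof (rule integral_spike_set)
    have "negligible {y :: real^2. axis 2 1 \<bullet> y = c $ 2}"
      by (intro negligible_hyperplane) (auto simp: axis_eq_0_iff)
    then show "negligible {x \<in> ball c r - polar c ` S. h x \<noteq> 0}"
      by (rule negligible_subset) (use ball_diff_polar_image[of c r] in \<open>auto simp: S_def\<close>)
    show "negligible {x \<in> polar c ` S - ball c r. h x \<noteq> 0}"
      using polar_image_subset[of c r] unfolding S_def
      by (intro empty_imp_negligible) blast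
  qed
  also have "\<dots> = integral (polar c ` S) (\<lambda>x. lift (h x)) $ 1"
    using cov integral_component_eq_cart[of "\<lambda>x. lift (h x)" "polar c ` S" 1]
    by (simp add: lift_def absolutely_integrable_on_def)
  also have "\<dots> = integral S (\<lambda>x. \<bar>det (matrix (P' x))\<bar> *\<^sub>R lift (h (polar c x))) $ 1"
    using cov by simp
  also have "\<dots> = integral S (\<lambda>x. (\<bar>det (matrix (P' x))\<bar> *\<^sub>R lift (h (polar c x))) $ 1)"
    using absF by (intro integral_component_eq_cart[symmetric]) (simp add: absolutely_integrable_on_def)
  also have "\<dots> = integral S F"
    by (intro integral_cong) (auto simp: det F_def lift_def S_def mem_box_cart forall_2)
  also have "\<dots> = integral (cbox 0 (vector [r, 2 * pi])) F"
    unfolding S_def by (rule integral_open_interval)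
  also have "\<dots> = integral (cbox (0, 0) (r, 2 * pi)) (\<lambda>(\<rho>, t). F (vector [\<rho>, t]))"
  proof -
    have "(F has_integral integral (cbox 0 (vector [r, 2 * pi])) F) (cbox 0 (vector [r, 2 * pi]))"
      by (intro integrable_integral integrable_continuous continuous_on_subset[OF contF]) auto
    from has_integral_pair_of_vector[OF this] show ?thesis
      by (simp add: integral_unique)
  qed
  finally show ?thesis
    by (simp add: F_def polar_def)
qed

text \<open>In polar coordinates, with radial direction \<open>e\<close> and tangential direction \<open>e'\<close>,
\<open>\<rho> div \<phi> = \<partial>\<^sub>\<rho>(\<rho> \<phi> \<bullet> e) + \<partial>\<^sub>t(\<phi> \<bullet> e')\<close>. Integrated first over \<open>t\<close>, the second term
vanishes by periodicity; integrated first over \<open>\<rho>\<close>, the first one leaves the boundary term.\<close>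

theorem divergence_theorem_disc:
  assumes \<phi>: "Ck 1 \<phi>" and "r > 0"
  shows "integral (ball c r) (divergence \<phi>) =
    integral {0..2 * pi} (\<lambda>t. r * (\<phi> (c + r *\<^sub>R circle_dir t) \<bullet> circle_dir t))"
proof -
  define D where "D x v = frechet_derivative \<phi> (at x) v" for x v
  define X where "X \<rho> t = c + \<rho> *\<^sub>R circle_dir t" for \<rho> t
  \<comment> \<open>The derivatives of \<open>\<rho> \<phi> \<bullet> e\<close> with respect to \<open>\<rho>\<close> and of \<open>\<phi> \<bullet> e'\<close> with respect to \<open>t\<close>.\<close>
  define A where "A \<rho> t = \<phi> (X \<rho> t) \<bullet> circle_dir t + \<rho> * (D (X \<rho> t) (circle_dir t) \<bullet> circle_dir t)" for \<rho> t
  define B where "B \<rho> t = \<rho> * (D (X \<rho> t) (circle_tan t) \<bullet> circle_tan t) - \<phi> (X \<rho> t) \<bullet> circle_dir t" for \<rho> t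
  have diff: "\<phi> differentiable (at x)" and contD: "continuous_on UNIV (\<lambda>x. D x v)" for x v
    using \<phi> by (auto simp: D_def)
  have der: "(\<phi> has_derivative D x) (at x)" for x
    using diff[of x] frechet_derivative_works unfolding D_def by blast
  have lin: "linear (D x)" for x
    using der has_derivative_linear by blast
  have cont\<phi>: "continuous_on UNIV \<phi>"
    using diff by (simp add: differentiable_imp_continuous_on differentiable_on_def differentiable_at_withinI)
  have D2: "D x (vector [a, b]) = a *\<^sub>R D x (axis 1 1) + b *\<^sub>R D x (axis 2 1)" for x a b
    unfolding vector_2_eq using lin[of x] by (simp add: linear_add linear_scale)
  have split: "\<rho> * divergence \<phi> (X \<rho> t) = A \<rho> t + B \<rho> t" for \<rho> t
  proof -
    define y where "y = X \<rho> t"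
    have cs: "sin t * (sin t * z) = z - cos t * (cos t * z)" for z
    proof -
      have "sin t * (sin t * z) + cos t * (cos t * z) = ((sin t)\<^sup>2 + (cos t)\<^sup>2) * z"
        by (simp only: power2_eq_square distrib_right mult.assoc)
      then show ?thesis by simp
    qed
    have "D y (circle_dir t) \<bullet> circle_dir t + D y (circle_tan t) \<bullet> circle_tan t = divergence \<phi> y"
      unfolding circle_dir_def circle_tan_def D2 divergence_def D_def[symmetric]
      by (simp add: inner_vec_def sum_2 algebra_simps cs)
    then show ?thesis
      unfolding A_def B_def y_def[symmetric] by (simp add: algebra_simps flip: distrib_left)
  qed
  have contX: "continuous_on UNIV (\<lambda>p. X (fst p) (snd p))"
    unfolding X_def circle_dir_def vector_2_eq by (intro continuous_intros)
  have contDX: "continuous_on UNIV (\<lambda>p. D (X (fst p) (snd p)) v)" for v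
    using continuous_on_compose2[OF contD contX] by auto
  have cont\<phi>X: "continuous_on UNIV (\<lambda>p. \<phi> (X (fst p) (snd p)))"
    using continuous_on_compose2[OF cont\<phi> contX] by auto
  have contA: "continuous_on Y (\<lambda>(\<rho>, t). A \<rho> t)" for Y
    unfolding case_prod_beta A_def circle_dir_def D2
    by (rule continuous_on_subset[of UNIV]) (auto intro!: continuous_intros contDX cont\<phi>X simp: vector_2_eq)
  have contB: "continuous_on Y (\<lambda>(\<rho>, t). B \<rho> t)" for Y
    unfolding case_prod_beta B_def circle_dir_def circle_tan_def D2
    by (rule continuous_on_subset[of UNIV]) (auto intro!: continuous_intros contDX cont\<phi>X simp: vector_2_eq)
  have "integral (ball c r) (divergence \<phi>) =
      integral (cbox (0, 0) (r, 2 * pi)) (\<lambda>(\<rho>, t). \<rho> * divergence \<phi> (X \<rho> t))"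
    unfolding X_def by (intro integral_ball_polar continuous_on_divergence assms)
  also have "\<dots> = integral (cbox (0, 0) (r, 2 * pi)) (\<lambda>p. (\<lambda>(\<rho>, t). A \<rho> t) p + (\<lambda>(\<rho>, t). B \<rho> t) p)"
    by (simp add: split case_prod_beta')
  also have "\<dots> = integral (cbox (0, 0) (r, 2 * pi)) (\<lambda>(\<rho>, t). A \<rho> t) +
      integral (cbox (0, 0) (r, 2 * pi)) (\<lambda>(\<rho>, t). B \<rho> t)"
    by (intro integral_add integrable_continuous contA contB)
  also have "integral (cbox (0, 0) (r, 2 * pi)) (\<lambda>(\<rho>, t). B \<rho> t) = 0"
  proof -
    have "(B \<rho> has_integral \<phi> (X \<rho> (2 * pi)) \<bullet> circle_tan (2 * pi) - \<phi> (X \<rho> 0) \<bullet> circle_tan 0) {0..2 * pi}" for \<rho>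
    proof (rule fundamental_theorem_of_calculus)
      fix t assume "t \<in> {0..2 * pi}"
      have "(X \<rho> has_vector_derivative 0 + \<rho> *\<^sub>R circle_tan t) (at t within {0..2 * pi})"
        unfolding X_def[abs_def]
        by (intro has_vector_derivative_add has_vector_derivative_const
            bounded_linear.has_vector_derivative[OF bounded_linear_scaleR_right] circle_dir_has_vector_derivative)
      from has_derivative_compose[OF this[unfolded has_vector_derivative_def] der]
      have "((\<lambda>t. \<phi> (X \<rho> t)) has_vector_derivative D (X \<rho> t) (\<rho> *\<^sub>R circle_tan t)) (at t within {0..2 * pi})"
        using lin[of "X \<rho> t"] by (simp add: has_vector_derivative_def linear_scale)
      from bounded_bilinear.has_vector_derivative[OF bounded_bilinear_inner this circle_tan_has_vector_derivative]
      show "((\<lambda>t. \<phi> (X \<rho> t) \<bullet> circle_tan t) has_vector_derivative B \<rho> t) (at t within {0..2 * pi})"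
        using lin[of "X \<rho> t"] by (simp add: B_def linear_scale algebra_simps)
    qed simp
    moreover have "X \<rho> (2 * pi) = X \<rho> 0" "circle_tan (2 * pi) = circle_tan 0" for \<rho>
      by (simp_all add: X_def circle_dir_def circle_tan_def)
    ultimately have "integral {0..2 * pi} (B \<rho>) = 0" for \<rho>
      by (simp add: integral_unique)
    then show ?thesis
      using integral_prod_continuous[OF contB, of 0 0 r "2 * pi"] by (simp add: cbox_interval)
  qed
  also have "integral (cbox (0, 0) (r, 2 * pi)) (\<lambda>(\<rho>, t). A \<rho> t) =
      integral {0..2 * pi} (\<lambda>t. integral {0..r} (\<lambda>\<rho>. A \<rho> t))"
    using integral_prod_continuous[OF contA, of 0 0 r "2 * pi"] integral_swap_continuous[OF contA, of 0 r 0 "2 * pi"]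
    by (simp add: cbox_interval)
  also have "\<dots> = integral {0..2 * pi} (\<lambda>t. r * (\<phi> (c + r *\<^sub>R circle_dir t) \<bullet> circle_dir t))"
  proof (rule integral_cong)
    fix t
    have "((\<lambda>\<rho>. A \<rho> t) has_integral r * (\<phi> (X r t) \<bullet> circle_dir t) - 0 * (\<phi> (X 0 t) \<bullet> circle_dir t)) {0..r}"
    proof (rule fundamental_theorem_of_calculus)
      fix \<rho> assume "\<rho> \<in> {0..r}"
      have "((\<lambda>\<rho>. X \<rho> t) has_vector_derivative circle_dir t) (at \<rho> within {0..r})"
        unfolding X_def by (auto intro!: derivative_eq_intros)
      from has_derivative_compose[OF this[unfolded has_vector_derivative_def] der]
      have "((\<lambda>\<rho>. \<phi> (X \<rho> t)) has_vector_derivative D (X \<rho> t) (circle_dir t)) (at \<rho> within {0..r})"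
        using lin[of "X \<rho> t"] by (simp add: has_vector_derivative_def linear_scale)
      then have "((\<lambda>\<rho>. \<phi> (X \<rho> t) \<bullet> circle_dir t) has_vector_derivative D (X \<rho> t) (circle_dir t) \<bullet> circle_dir t) (at \<rho> within {0..r})"
        by (rule bounded_linear.has_vector_derivative[OF bounded_linear_inner_left])
      from has_vector_derivative_mult[OF has_vector_derivative_id this]
      show "((\<lambda>\<rho>. \<rho> * (\<phi> (X \<rho> t) \<bullet> circle_dir t)) has_vector_derivative A \<rho> t) (at \<rho> within {0..r})"
        by (simp add: A_def add.commute)
    qed (use assms in simp)
    then show "integral {0..r} (\<lambda>\<rho>. A \<rho> t) = r * (\<phi> (c + r *\<^sub>R circle_dir t) \<bullet> circle_dir t)"
      by (simp add: integral_unique X_def)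
  qed
  finally show ?thesis by simp
qed

section \<open>Integrals of the datum\<close>

lemma absolutely_integrable_continuous_ball:
  fixes h :: "real^2 \<Rightarrow> real"
  assumes "continuous_on UNIV h"
  shows "h absolutely_integrable_on ball c r"
proof -
  obtain a where a: "ball c r \<subseteq> cbox (- a) a"
    using bounded_subset_cbox_symmetric[OF bounded_ball] by blast
  have "h absolutely_integrable_on cbox (- a) a"
    by (intro absolutely_integrable_continuous continuous_on_subset[OF assms]) auto
  then show ?thesis
    by (rule set_integrable_subset) (use a in auto)
qed

lemma signed_balls_integral:
  assumes \<Omega>: "\<Omega> \<in> sets lebesgue" and sub: "ball (vector [r, 0]) r \<subseteq> \<Omega>" "ball (vector [- r, 0]) r \<subseteq> \<Omega>"
    and h: "continuous_on UNIV h"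
  shows "integrable (lebesgue_on \<Omega>) (\<lambda>x. signed_balls r x * h x)"
    and "(LINT x|lebesgue_on \<Omega>. signed_balls r x * h x) =
      integral (ball (vector [r, 0]) r) h - integral (ball (vector [- r, 0]) r) h"
proof -
  have eq: "(\<lambda>x. indicator \<Omega> x *\<^sub>R (signed_balls r x * h x)) =
      (\<lambda>x. indicator (ball (vector [r, 0]) r) x *\<^sub>R h x - indicator (ball (vector [- r, 0]) r) x *\<^sub>R h x)"
    using sub by (auto simp: fun_eq_iff signed_balls_def indicator_def)
  have abs: "integrable lebesgue (\<lambda>x. indicator (ball c r) x *\<^sub>R h x)" for c
    using absolutely_integrable_continuous_ball[OF h, of c r] by (simp add: set_integrable_def)
  have "integrable lebesgue (\<lambda>x. indicator \<Omega> x *\<^sub>R (signed_balls r x * h x))"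
    unfolding eq by (intro Bochner_Integration.integrable_diff abs)
  with \<Omega> show "integrable (lebesgue_on \<Omega>) (\<lambda>x. signed_balls r x * h x)"
    by (simp add: integrable_restrict_space)
  have "(LINT x|lebesgue_on \<Omega>. signed_balls r x * h x) = (LINT x|lebesgue. indicator \<Omega> x *\<^sub>R (signed_balls r x * h x))"
    using \<Omega> by (subst integral_restrict_space) auto
  also have "\<dots> = (LINT x|lebesgue. indicator (ball (vector [r, 0]) r) x *\<^sub>R h x) -
      (LINT x|lebesgue. indicator (ball (vector [- r, 0]) r) x *\<^sub>R h x)"
    unfolding eq by (intro Bochner_Integration.integral_diff abs)
  also have "\<dots> = integral (ball (vector [r, 0]) r) h - integral (ball (vector [- r, 0]) r) h"
    using set_lebesgue_integral_eq_integral(2)[OF absolutely_integrable_continuous_ball[OF h]]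
    by (simp add: set_lebesgue_integral_def)
  finally show "(LINT x|lebesgue_on \<Omega>. signed_balls r x * h x) =
      integral (ball (vector [r, 0]) r) h - integral (ball (vector [- r, 0]) r) h" .
qed

lemma signed_balls_square_integral:
  assumes \<Omega>: "\<Omega> \<in> sets lebesgue" and sub: "ball (vector [r, 0]) r \<subseteq> \<Omega>" "ball (vector [- r, 0]) r \<subseteq> \<Omega>"
    and "r > 0"
  shows "integrable (lebesgue_on \<Omega>) (\<lambda>x. (signed_balls r x)\<^sup>2)"
    and "(LINT x|lebesgue_on \<Omega>. (signed_balls r x)\<^sup>2) = 2 * pi * r\<^sup>2"
proof -
  have disj: "x \<notin> ball (vector [- r, 0]) r" if "x \<in> ball (vector [r, 0]) r" for x :: "real^2"
  proof
    assume "x \<in> ball (vector [- r, 0]) r"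
    with that have 1: "(x $ 1 - r)\<^sup>2 + (x $ 2)\<^sup>2 < r\<^sup>2" "(x $ 1 + r)\<^sup>2 + (x $ 2)\<^sup>2 < r\<^sup>2"
      using mem_ball_2[OF \<open>r > 0\<close>, of x _ 0] by (metis diff_0_right, metis diff_0_right diff_minus_eq_add)
    have "(x $ 1 - r)\<^sup>2 + (x $ 1 + r)\<^sup>2 = 2 * (x $ 1)\<^sup>2 + 2 * r\<^sup>2"
      by (simp add: power2_eq_square algebra_simps)
    with 1 zero_le_power2[of "x $ 1"] zero_le_power2[of "x $ 2"] show False by linarith
  qed
  have eq: "(\<lambda>x. indicator \<Omega> x *\<^sub>R (signed_balls r x)\<^sup>2) =
      (\<lambda>x. indicator (ball (vector [r, 0]) r) x + indicator (ball (vector [- r, 0]) r) x)"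
    using sub disj by (auto simp: fun_eq_iff signed_balls_def indicator_def)
  have int: "integrable lebesgue (indicator (ball c r) :: real^2 \<Rightarrow> real)" for c
    by (simp add: lmeasurable_iff_integrable[symmetric])
  have content: "(LINT x|lebesgue. indicator (ball c r) x) = pi * r\<^sup>2" for c :: "real^2"
    using content_ball[of r c] \<open>r > 0\<close> by (simp add: unit_ball_vol_2 power2_eq_square)
  have "integrable lebesgue (\<lambda>x. indicator \<Omega> x *\<^sub>R (signed_balls r x)\<^sup>2)"
    unfolding eq by (intro Bochner_Integration.integrable_add int)
  with \<Omega> show "integrable (lebesgue_on \<Omega>) (\<lambda>x. (signed_balls r x)\<^sup>2)"
    by (simp add: integrable_restrict_space)
  have "(LINT x|lebesgue_on \<Omega>. (signed_balls r x)\<^sup>2) = (LINT x|lebesgue. indicator \<Omega> x *\<^sub>R (signed_balls r x)\<^sup>2)"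
    using \<Omega> by (subst integral_restrict_space) auto
  also have "\<dots> = (LINT x|lebesgue. indicator (ball (vector [r, 0]) r) (x :: real^2)) + (LINT x|lebesgue. indicator (ball (vector [- r, 0]) r) (x :: real^2))"
    unfolding eq by (rule Bochner_Integration.integral_add[OF int int])
  finally show "(LINT x|lebesgue_on \<Omega>. (signed_balls r x)\<^sup>2) = 2 * pi * r\<^sup>2"
    unfolding content by simp
qed

section \<open>The gradient measure of the datum\<close>

text \<open>One parametrization of both circles: the right one for \<open>t\<close> in \<open>[0, 2 \<pi>]\<close>, the left one for \<open>t\<close> in \<open>[- 2 \<pi>, 0)\<close>.
A single curve makes the measure a single image measure instead of a sum of two.\<close>

definition circles :: "real \<Rightarrow> real \<Rightarrow> real^2" where
  "circles r t = (if t \<ge> 0 then vector [r, 0] + r *\<^sub>R circle_dir t else vector [- r, 0] + r *\<^sub>R circle_dir (- t))"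

text \<open>The direction in which \<open>g\<close> increases across the circles: the interior normal on the right circle, the exterior
normal on the left one. The circles touch at the origin, which is the image of a null set of parameters; there the value
is the normal of the left circle.\<close>

definition circles_normal :: "real \<Rightarrow> real^2 \<Rightarrow> real^2" where
  "circles_normal r x = (if x $ 1 > 0 then - ((x - vector [r, 0]) /\<^sub>R r) else (x - vector [- r, 0]) /\<^sub>R r)"

text \<open>The parametrization has speed \<open>r\<close>, so the density \<open>c r\<close> produces \<open>c\<close> times arc length.\<close>

definition circles_measure :: "(real^2) set \<Rightarrow> real \<Rightarrow> real \<Rightarrow> (real^2) measure" where
  "circles_measure \<Omega> c r = distr (density (restrict_space lborel {- (2 * pi)..2 * pi}) (\<lambda>_. ennreal (c * r)))
     (restrict_space borel \<Omega>) (circles r)"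

lemma circles_normal_circles_neg:
  assumes "r > 0" "t < 0"
  shows "circles_normal r (circles r t) = circle_dir (- t)"
proof -
  have "circles r t $ 1 \<le> 0"
    using assms by (simp add: circles_def circle_dir_def)
  then show ?thesis
    using assms by (simp add: circles_normal_def circles_def)
qed

text \<open>At \<open>t = \<pi>\<close> the right circle passes through the origin, where the normal of the left circle was chosen.\<close>

lemma circles_normal_circles_pos:
  assumes "r > 0" "0 \<le> t" "t \<le> 2 * pi" "t \<noteq> pi"
  shows "circles_normal r (circles r t) = - circle_dir t"
proof -
  have "cos t \<noteq> -1"
  proof
    assume "cos t = -1"
    then have "cos (t - pi) = 1" by (simp add: cos_diff)
    then obtain n :: int where n: "t - pi = real_of_int n * 2 * pi"
      using cos_one_2pi_int by blast
    then have "real_of_int n * 2 * pi \<le> 1 * pi" "- 1 * pi \<le> real_of_int n * 2 * pi"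
      using assms by linarith+
    then have "real_of_int n * 2 \<le> 1" "- 1 \<le> real_of_int n * 2"
      by (simp_all only: mult_le_cancel_right_pos[OF pi_gt_zero])
    then have "n = 0" by linarith
    with n assms show False by simp
  qed
  then have "cos t > -1" using cos_ge_minus_one[of t] by linarith
  then have "r * (-1) < r * cos t" using assms by (intro mult_strict_left_mono) auto
  then have "circles r t $ 1 > 0"
    using assms by (simp add: circles_def circle_dir_def)
  then show ?thesis
    using assms by (simp add: circles_normal_def circles_def)
qed

lemma norm_circles_normal:
  assumes "r > 0" "t \<in> {- (2 * pi)..2 * pi}"
  shows "norm (circles_normal r (circles r t)) = 1"
proof -
  consider "t < 0" | "t \<ge> 0" "t \<noteq> pi" | "t = pi" by linarith
  then show ?thesis
  proof cases
    case 3
    have "circles r pi = 0"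
      using assms by (simp add: circles_def circle_dir_def vec_eq_iff forall_2)
    then show ?thesis
      using assms 3 by (simp add: circles_normal_def norm_2 real_sqrt_mult)
  qed (use assms circles_normal_circles_neg circles_normal_circles_pos in auto)
qed

lemma measurable_circles [measurable]: "circles r \<in> borel_measurable borel"
proof -
  have "continuous_on UNIV circle_dir"
    unfolding circle_dir_def[abs_def] vector_2_eq by (intro continuous_intros)
  then have [measurable]: "circle_dir \<in> borel_measurable borel"
    by (rule borel_measurable_continuous_onI)
  show ?thesis unfolding circles_def[abs_def] by measurable
qed

lemma measurable_circles_normal [measurable]: "circles_normal r \<in> borel_measurable borel"
proof -
  have [measurable]: "(\<lambda>x :: real^2. x $ 1) \<in> borel_measurable borel"
    by (intro borel_measurable_continuous_onI continuous_intros)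
  show ?thesis unfolding circles_normal_def[abs_def] by measurable
qed

lemma circles_measurable_into:
  assumes "r > 0" "cball (vector [r, 0]) r \<subseteq> \<Omega>" "cball (vector [- r, 0]) r \<subseteq> \<Omega>"
  shows "circles r \<in> measurable (density (restrict_space lborel S) w) (restrict_space borel \<Omega>)"
proof -
  have "circles r t \<in> \<Omega>" for t
  proof -
    have "vector [r, 0] + r *\<^sub>R circle_dir s \<in> cball (vector [r, 0]) r"
      "vector [- r, 0] + r *\<^sub>R circle_dir s \<in> cball (vector [- r, 0]) r" for s
      using assms(1) by (simp_all add: dist_norm)
    then show ?thesis using assms(2,3) unfolding circles_def by auto
  qed
  then show ?thesis
    by (intro measurable_restrict_space2) (auto intro!: measurable_restrict_space1)
qed

text \<open>Up to the parameters \<open>\<pi>\<close> and 0 the integrand is continuous on each of the two parameter intervals, and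
\<open>t \<mapsto> - t\<close> carries the left one to \<open>[0, 2 \<pi>]\<close>.\<close>

lemma integral_circles_measure:
  assumes "r > 0" "c \<ge> 0" "cball (vector [r, 0]) r \<subseteq> \<Omega>" "cball (vector [- r, 0]) r \<subseteq> \<Omega>"
    and \<phi>: "continuous_on UNIV \<phi>"
  shows "(LINT x|circles_measure \<Omega> c r. \<phi> x \<bullet> circles_normal r x) =
    c * (integral {0..2 * pi} (\<lambda>t. r * (\<phi> (vector [- r, 0] + r *\<^sub>R circle_dir t) \<bullet> circle_dir t))
       - integral {0..2 * pi} (\<lambda>t. r * (\<phi> (vector [r, 0] + r *\<^sub>R circle_dir t) \<bullet> circle_dir t)))"
proof -
  define G where "G a t = r * (\<phi> (vector [a, 0] + r *\<^sub>R circle_dir t) \<bullet> circle_dir t)" for a t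
  define F where "F t = (c * r) *\<^sub>R (\<phi> (circles r t) \<bullet> circles_normal r (circles r t))" for t
  have [measurable]: "\<phi> \<in> borel_measurable borel"
    using \<phi> by (rule borel_measurable_continuous_onI)
  have contG: "continuous_on S (G a)" for a S
    unfolding G_def circle_dir_def vector_2_eq
    by (intro continuous_intros continuous_on_compose2[OF \<phi>]) auto
  have F_pos: "F t = - c * G r t" if "t \<in> {0..2 * pi} - {pi}" for t
    using circles_normal_circles_pos[OF assms(1), of t] that
    by (simp add: F_def G_def circles_def)
  have F_neg: "F t = c * G (- r) (- t)" if "t \<in> {- (2 * pi)..0} - {0}" for t
    using circles_normal_circles_neg[OF assms(1), of t] that
    by (simp add: F_def G_def circles_def)
  have "(LINT x|circles_measure \<Omega> c r. \<phi> x \<bullet> circles_normal r x) =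
      (LINT t|density (restrict_space lborel {- (2 * pi)..2 * pi}) (\<lambda>_. ennreal (c * r)).
         \<phi> (circles r t) \<bullet> circles_normal r (circles r t))"
    unfolding circles_measure_def
    by (rule integral_distr[OF circles_measurable_into[OF assms(1,3,4)]])
      (intro measurable_restrict_space1, measurable)
  also have "\<dots> = (LINT t|restrict_space lborel {- (2 * pi)..2 * pi}. F t)"
    unfolding F_def using assms
    by (intro integral_density) (auto intro!: measurable_restrict_space1)
  also have "\<dots> = (LINT t:{- (2 * pi)..2 * pi}|lborel. F t)"
    unfolding set_lebesgue_integral_def by (subst integral_restrict_space) auto
  also have "\<dots> = integral {- (2 * pi)..2 * pi} F"
  proof (rule set_borel_integral_eq_integral(2))
    have "F absolutely_integrable_on {0..2 * pi}"
    proof (rule absolutely_integrable_spike[where S = "{pi}"])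
      show "(\<lambda>t. - c * G r t) absolutely_integrable_on {0..2 * pi}"
        by (intro absolutely_integrable_continuous_real continuous_intros contG)
    qed (use F_pos in auto)
    moreover have "F absolutely_integrable_on {- (2 * pi)..0}"
    proof (rule absolutely_integrable_spike[where S = "{0}"])
      show "(\<lambda>t. c * G (- r) (- t)) absolutely_integrable_on {- (2 * pi)..0}"
        by (intro absolutely_integrable_continuous_real continuous_intros continuous_on_compose2[OF contG[of UNIV]]) auto
    qed (use F_neg in auto)
    ultimately have "F absolutely_integrable_on ({- (2 * pi)..0} \<union> {0..2 * pi})"
      by (intro set_integrable_Un) auto
    moreover have "{- (2 * pi)..0} \<union> {0..2 * pi} = {- (2 * pi)..2 * pi}"
      by (intro ivl_disj_un_two_touch) auto
    ultimately show "set_integrable lborel {- (2 * pi)..2 * pi} F"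
      unfolding set_integrable_def by (subst (asm) integrable_completion) (auto simp: F_def)
  qed
  also have "\<dots> = c * (integral {0..2 * pi} (G (- r)) - integral {0..2 * pi} (G r))"
  proof -
    have pos: "(F has_integral - c * integral {0..2 * pi} (G r)) {0..2 * pi}"
    proof (rule has_integral_spike[of "{pi}"])
      show "((\<lambda>t. - c * G r t) has_integral - c * integral {0..2 * pi} (G r)) {0..2 * pi}"
        by (intro has_integral_mult_right integrable_integral integrable_continuous_real contG)
    qed (use F_pos in auto)
    have neg: "(F has_integral c * integral {0..2 * pi} (G (- r))) {- (2 * pi)..0}"
    proof (rule has_integral_spike[of "{0}"])
      have "((\<lambda>t. c * G (- r) t) has_integral c * integral {0..2 * pi} (G (- r))) {0..2 * pi}"
        by (intro has_integral_mult_right integrable_integral integrable_continuous_real contG)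
      then have "((\<lambda>t. c * G (- r) (- t)) has_integral c * integral {0..2 * pi} (G (- r))) {- (2 * pi)..- 0}"
        using has_integral_reflect_real[where f = "\<lambda>t. c * G (- r) t"] by blast
      then show "((\<lambda>t. c * G (- r) (- t)) has_integral c * integral {0..2 * pi} (G (- r))) {- (2 * pi)..0}"
        by simp
    qed (use F_neg in auto)
    have "(F has_integral c * integral {0..2 * pi} (G (- r)) + - c * integral {0..2 * pi} (G r)) {- (2 * pi)..2 * pi}"
      using neg pos by (intro has_integral_combine[of "- (2 * pi)" 0]) auto
    then show ?thesis by (simp add: integral_unique algebra_simps)
  qed
  finally show ?thesis by (simp add: G_def[abs_def])
qed

lemma Ck_imp_continuous: "Ck 1 \<phi> \<Longrightarrow> continuous_on UNIV \<phi>"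
  unfolding Ck_eq_cont_diff using cont_diff_Suc_imp[of 0 \<phi>] by simp

lemma total_variation_nonneg: "0 \<le> total_variation \<Omega> u"
proof -
  have d0: "divergence (\<lambda>_. 0) x = 0" for x
    by (simp add: divergence_def)
  have "(\<lambda>_. 0) \<in> test_fields \<Omega>"
    by (simp add: test_fields_def Ck_eq_cont_diff cont_diff_const)
  from total_variation_ge[OF this, of u] show ?thesis
    by (simp add: d0 zero_ereal_def)
qed

context
  fixes \<Omega> :: "(real^2) set" and r c :: real
  assumes \<Omega>: "open \<Omega>" and r: "r > 0" and c: "c \<ge> 0"
    and sub: "cball (vector [r, 0]) r \<subseteq> \<Omega>" "cball (vector [- r, 0]) r \<subseteq> \<Omega>"
begin

lemma balls_subset: "ball (vector [r, 0]) r \<subseteq> \<Omega>" "ball (vector [- r, 0]) r \<subseteq> \<Omega>" "\<Omega> \<in> sets lebesgue"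
  using sub ball_subset_cball \<Omega> by (auto simp: borel_open)

lemma integral_scaled_balls_divergence:
  assumes "Ck 1 \<phi>"
  shows "(LINT x|lebesgue_on \<Omega>. (c * signed_balls r x) * divergence \<phi> x) =
    c * (integral {0..2 * pi} (\<lambda>t. r * (\<phi> (vector [r, 0] + r *\<^sub>R circle_dir t) \<bullet> circle_dir t))
       - integral {0..2 * pi} (\<lambda>t. r * (\<phi> (vector [- r, 0] + r *\<^sub>R circle_dir t) \<bullet> circle_dir t)))"
proof -
  have "(LINT x|lebesgue_on \<Omega>. (c * signed_balls r x) * divergence \<phi> x) =
      c * (LINT x|lebesgue_on \<Omega>. signed_balls r x * divergence \<phi> x)"
    unfolding mult.assoc by (rule integral_mult_right_zero)
  also have "(LINT x|lebesgue_on \<Omega>. signed_balls r x * divergence \<phi> x) =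
      integral (ball (vector [r, 0]) r) (divergence \<phi>) - integral (ball (vector [- r, 0]) r) (divergence \<phi>)"
    by (rule signed_balls_integral(2)[OF balls_subset(3,1,2) continuous_on_divergence[OF assms]])
  finally show ?thesis
    unfolding divergence_theorem_disc[OF assms r] .
qed

lemma gradient_scaled_balls:
  assumes "Ck 1 \<phi>"
  shows "(LINT x|lebesgue_on \<Omega>. (c * signed_balls r x) * divergence \<phi> x) =
    - (LINT x|circles_measure \<Omega> c r. \<phi> x \<bullet> circles_normal r x)"
  unfolding integral_scaled_balls_divergence[OF assms]
    integral_circles_measure[OF r c sub Ck_imp_continuous[OF assms]]
  by (simp add: algebra_simps)

lemma is_gradient_measure_scaled_balls:
  "is_gradient_measure \<Omega> (\<lambda>x. c * signed_balls r x) (circles_measure \<Omega> c r) (circles_normal r)"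
  unfolding is_gradient_measure_def
proof (intro conjI ballI)
  let ?N = "density (restrict_space lborel {- (2 * pi)..2 * pi}) (\<lambda>_. ennreal (c * r))"
  note meas = circles_measurable_into[OF r sub]
  show sets: "sets (circles_measure \<Omega> c r) = sets (restrict_space borel \<Omega>)"
    by (simp add: circles_measure_def)
  show "finite_measure (circles_measure \<Omega> c r)"
    unfolding circles_measure_def
  proof (rule finite_measure.finite_measure_distr[OF _ meas])
    show "finite_measure ?N"
    proof
      have "emeasure ?N (space ?N) =
          ennreal (c * r) * emeasure (restrict_space lborel {- (2 * pi)..2 * pi}) {- (2 * pi)..2 * pi}"
        unfolding space_density by (subst emeasure_density_const) (auto simp: space_restrict_space sets_restrict_space)
      also have "\<dots> = ennreal (c * r) * ennreal (4 * pi)"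
        by (simp add: emeasure_restrict_space)
      also have "\<dots> \<noteq> \<infinity>" by (simp add: ennreal_mult_eq_top_iff)
      finally show "emeasure ?N (space ?N) \<noteq> \<infinity>" .
    qed
  qed
  show "circles_normal r \<in> borel_measurable (circles_measure \<Omega> c r)"
    unfolding measurable_cong_sets[OF sets refl]
    by (intro measurable_restrict_space1) simp
  have "(\<lambda>x. norm (circles_normal r x)) \<in> borel_measurable (restrict_space borel \<Omega>)"
    by (intro measurable_restrict_space1 borel_measurable_norm) simp
  from measurable_sets[OF this, of "{1}"]
  have level: "{x \<in> space (restrict_space borel \<Omega>). norm (circles_normal r x) = 1} \<in> sets (restrict_space borel \<Omega>)"
    by (simp add: vimage_def Int_def conj_commute)
  have "AE t in ?N. norm (circles_normal r (circles r t)) = 1"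
    by (intro AE_I2) (use r in \<open>auto simp: space_restrict_space intro!: norm_circles_normal\<close>)
  then show "AE x in circles_measure \<Omega> c r. norm (circles_normal r x) = 1"
    unfolding circles_measure_def using AE_distr_iff[OF meas level] by blast
  show "(LINT x|lebesgue_on \<Omega>. (c * signed_balls r x) * divergence \<phi> x) =
      - (LINT x|circles_measure \<Omega> c r. \<phi> x \<bullet> circles_normal r x)" if "\<phi> \<in> test_fields \<Omega>" for \<phi>
    using that gradient_scaled_balls unfolding test_fields_def by blast
qed

lemma total_variation_scaled_balls_le:
  "total_variation \<Omega> (\<lambda>x. c * signed_balls r x) \<le> ereal (4 * pi * r * c)"
  unfolding total_variation_def
proof (rule SUP_least)
  fix \<phi> assume "\<phi> \<in> {\<phi> \<in> test_fields \<Omega>. \<forall>x. norm (\<phi> x) \<le> 1}"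
  then have \<phi>: "Ck 1 \<phi>" "\<And>x. norm (\<phi> x) \<le> 1" by (auto simp: test_fields_def)
  define I where "I a = integral {0..2 * pi} (\<lambda>t. r * (\<phi> (vector [a, 0] + r *\<^sub>R circle_dir t) \<bullet> circle_dir t))" for a
  have I: "\<bar>I a\<bar> \<le> 2 * pi * r" for a
  proof -
    have "norm (I a) \<le> r * (2 * pi - 0)"
      unfolding I_def
    proof (rule integral_bound)
      show "continuous_on {0..2 * pi} (\<lambda>t. r * (\<phi> (vector [a, 0] + r *\<^sub>R circle_dir t) \<bullet> circle_dir t))"
        unfolding circle_dir_def vector_2_eq
        by (intro continuous_intros continuous_on_compose2[OF Ck_imp_continuous[OF \<phi>(1)]]) auto
      fix t
      have "\<bar>\<phi> y \<bullet> circle_dir t\<bar> \<le> 1" for y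
        using Cauchy_Schwarz_ineq2[of "\<phi> y" "circle_dir t"] \<phi>(2)[of y] by simp
      then show "norm (r * (\<phi> (vector [a, 0] + r *\<^sub>R circle_dir t) \<bullet> circle_dir t)) \<le> r"
        using r by (simp add: abs_mult)
    qed simp
    then show ?thesis by (simp add: mult_ac)
  qed
  have "I (- r) - I r \<le> 4 * pi * r"
    using I[of r] I[of "- r"] by linarith
  moreover have "- (c * (I r - I (- r))) = c * (I (- r) - I r)" by (simp add: algebra_simps)
  ultimately have "- (c * (I r - I (- r))) \<le> c * (4 * pi * r)"
    using mult_left_mono[OF _ c] by metis
  then show "ereal (- (LINT x|lebesgue_on \<Omega>. (c * signed_balls r x) * divergence \<phi> x)) \<le> ereal (4 * pi * r * c)"
    unfolding integral_scaled_balls_divergence[OF \<phi>(1)] I_def by (simp add: mult_ac)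
qed

text \<open>The circles lie in \<open>\<Omega>\<close>, so the Gauss-Green formula holds for every \<open>C\<^sup>1\<close> field with the gradient measure alone.
This says that the trace is zero.\<close>

lemma scaled_balls_admissible: "(\<lambda>x. c * signed_balls r x) \<in> admissible \<Omega>"
proof -
  have int: "integrable (lebesgue_on \<Omega>) (signed_balls r)"
    using signed_balls_integral(1)[OF balls_subset(3,1,2), of "\<lambda>_. 1"] by simp
  have "total_variation \<Omega> (\<lambda>x. c * signed_balls r x) < \<infinity>"
    using total_variation_scaled_balls_le by (auto intro: order.strict_trans1)
  then have BV: "(\<lambda>x. c * signed_balls r x) \<in> BV \<Omega>"
    using int by (simp add: BV_def)
  have L2: "(\<lambda>x. c * signed_balls r x) \<in> L2 \<Omega>"
    using int signed_balls_square_integral(1)[OF balls_subset(3,1,2) r]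
    by (auto simp: L2_def power_mult_distrib)
  have "has_trace \<Omega> (\<lambda>x. c * signed_balls r x) (\<lambda>_. 0)"
    unfolding has_trace_def
    using BV is_gradient_measure_scaled_balls gradient_scaled_balls
    by (auto simp: set_integrable_def set_lebesgue_integral_def)
  with BV L2 show ?thesis by (simp add: admissible_def)
qed

end

section \<open>The minimizer\<close>

lemma L2_norm_square: "(L2_norm \<Omega> u)\<^sup>2 = (LINT x|lebesgue_on \<Omega>. (u x)\<^sup>2)"
  by (simp add: L2_norm_def)

theorem proposition3p1:
  fixes \<Omega> :: "(real^2) set" and r \<alpha> c :: real and g :: "real^2 \<Rightarrow> real"
  assumes "bounded \<Omega>" and "lipschitz_domain \<Omega>"
    and "(\<lambda>x. vector [- (x $ 1), x $ 2] :: real^2) ` \<Omega> = \<Omega>"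
    and "r > 0"
    and "closure (ball (vector [r, 0]) r) \<subseteq> \<Omega>"
    and "closure (ball (vector [- r, 0]) r) \<subseteq> \<Omega>"
    and "\<alpha> > 0"
    and "g = (\<lambda>x. indicator (ball (vector [r, 0]) r) x - indicator (ball (vector [- r, 0]) r) x)"
    and "c = max (1 - 2 / (\<alpha> * r)) 0"
  shows "is_minimizer \<Omega> \<alpha> g (\<lambda>x. c * g x) \<and>
    (\<forall>u. is_minimizer \<Omega> \<alpha> g u \<longrightarrow> (AE x in lebesgue_on \<Omega>. u x = c * g x))"
proof -
  have g: "g = signed_balls r"
    using assms(8) by (simp add: fun_eq_iff signed_balls_def)
  have op: "open \<Omega>" using assms(2) by (simp add: lipschitz_domain_def)
  note r = \<open>r > 0\<close> and \<alpha> = \<open>\<alpha> > 0\<close>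
  have sub: "cball (vector [r, 0]) r \<subseteq> \<Omega>" "cball (vector [- r, 0]) r \<subseteq> \<Omega>"
    using assms(5,6) r by (simp_all add: closure_ball)
  have c: "c \<ge> 0" using assms(9) by simp
  have adm: "(\<lambda>x. c * g x) \<in> admissible \<Omega>"
    unfolding g by (rule scaled_balls_admissible[OF op r c sub])
  define m where "m = 1 - c"
  define \<kappa> where "\<kappa> = \<alpha> * m"
  define G where "G = (LINT x|lebesgue_on \<Omega>. (g x)\<^sup>2)"
  define W where "W v = (LINT x|lebesgue_on \<Omega>. v x * g x)" for v
  define Q where "Q v = (LINT x|lebesgue_on \<Omega>. (v x - c * g x)\<^sup>2)" for v
  define K where "K = \<kappa> * c * G + \<alpha> / 2 * m\<^sup>2 * G"
  have \<Omega>m: "\<Omega> \<in> sets lebesgue" and bsub: "ball (vector [r, 0]) r \<subseteq> \<Omega>" "ball (vector [- r, 0]) r \<subseteq> \<Omega>"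
    using sub ball_subset_cball op by (auto simp: borel_open)
  have gi: "integrable (lebesgue_on \<Omega>) g"
    using signed_balls_integral(1)[OF \<Omega>m bsub, of "\<lambda>_. 1"] by (simp add: g)
  have g2i: "integrable (lebesgue_on \<Omega>) (\<lambda>x. (g x)\<^sup>2)" and G: "G = 2 * pi * r\<^sup>2"
    using signed_balls_square_integral[OF \<Omega>m bsub r] by (simp_all add: g G_def)
  have m: "m \<ge> 0" "m \<le> 2 / (\<alpha> * r)"
    using assms(9) r \<alpha> by (auto simp: m_def max_def)
  have \<kappa>: "\<kappa> \<ge> 0" "\<kappa> \<le> 2 / r"
    using mult_left_mono[OF m(2), of \<alpha>] m(1) r \<alpha> by (auto simp: \<kappa>_def)
  \<comment> \<open>The variation of \<open>c g\<close> attains the lower bound given by the calibration.\<close>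
  have \<kappa>c: "4 * pi * r * c = \<kappa> * c * G"
  proof (cases "c = 0")
    case False
    then have "m = 2 / (\<alpha> * r)" using assms(9) by (auto simp: m_def max_def split: if_splits)
    then have "\<kappa> = 2 / r" using \<alpha> by (simp add: \<kappa>_def)
    then show ?thesis using r by (simp add: G power2_eq_square)
  qed simp
  have lower: "ereal (K + \<alpha> / 2 * Q v) \<le> functional_I \<Omega> \<alpha> g v"
    and Qi: "integrable (lebesgue_on \<Omega>) (\<lambda>x. (v x - c * g x)\<^sup>2)" if v: "v \<in> admissible \<Omega>" for v
  proof -
    have vi: "integrable (lebesgue_on \<Omega>) v" and v2i: "integrable (lebesgue_on \<Omega>) (\<lambda>x. (v x)\<^sup>2)"
      and tr: "has_trace \<Omega> v (\<lambda>_. 0)"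
      using v by (auto simp: admissible_def BV_def L2_def)
    have vgi: "integrable (lebesgue_on \<Omega>) (\<lambda>x. v x * g x)"
    proof (rule Bochner_Integration.integrable_bound[OF vi])
      show "(\<lambda>x. v x * g x) \<in> borel_measurable (lebesgue_on \<Omega>)"
        using vi gi by (intro borel_measurable_times) auto
      have "\<bar>g x\<bar> \<le> 1" for x
        unfolding g signed_balls_eq[OF r] by (simp add: abs_sgn_eq)
      then show "AE x in lebesgue_on \<Omega>. norm (v x * g x) \<le> norm (v x)"
        by (intro AE_I2) (simp add: abs_mult mult_left_le)
    qed
    have sq: "(LINT x|lebesgue_on \<Omega>. (a * g x - v x)\<^sup>2) = a\<^sup>2 * G - 2 * a * W v + (LINT x|lebesgue_on \<Omega>. (v x)\<^sup>2)"
      and sqi: "integrable (lebesgue_on \<Omega>) (\<lambda>x. (a * g x - v x)\<^sup>2)" for a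
    proof -
      have eq: "(\<lambda>x. (a * g x - v x)\<^sup>2) = (\<lambda>x. a\<^sup>2 * (g x)\<^sup>2 - 2 * a * (v x * g x) + (v x)\<^sup>2)"
        by (simp add: fun_eq_iff power2_eq_square algebra_simps)
      show "integrable (lebesgue_on \<Omega>) (\<lambda>x. (a * g x - v x)\<^sup>2)"
        unfolding eq using g2i vgi v2i by simp
      show "(LINT x|lebesgue_on \<Omega>. (a * g x - v x)\<^sup>2) = a\<^sup>2 * G - 2 * a * W v + (LINT x|lebesgue_on \<Omega>. (v x)\<^sup>2)"
        unfolding eq using g2i vgi v2i by (simp add: G_def W_def)
    qed
    show "integrable (lebesgue_on \<Omega>) (\<lambda>x. (v x - c * g x)\<^sup>2)"
      using sqi[of c] by (simp add: power2_commute)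
    have Q: "Q v = c\<^sup>2 * G - 2 * c * W v + (LINT x|lebesgue_on \<Omega>. (v x)\<^sup>2)"
      using sq[of c] by (simp add: Q_def power2_commute)
    have L: "(L2_norm \<Omega> (\<lambda>x. g x - v x))\<^sup>2 = G - 2 * W v + (LINT x|lebesgue_on \<Omega>. (v x)\<^sup>2)"
      using sq[of 1] by (simp add: L2_norm_square)
    have "ereal (\<kappa> * W v) \<le> total_variation \<Omega> v"
    proof (cases "W v \<ge> 0")
      case True
      then have "ereal (\<kappa> * W v) \<le> ereal (2 / r * W v)"
        using \<kappa>(2) by (simp add: mult_right_mono del: times_divide_eq_left)
      also have "\<dots> \<le> total_variation \<Omega> v"
        unfolding W_def g by (rule total_variation_ge_signed_balls[OF op r tr])
      finally show ?thesis .
    next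
      case False
      then have "ereal (\<kappa> * W v) \<le> 0" using \<kappa>(1) by (simp add: mult_nonneg_nonpos)
      then show ?thesis using total_variation_nonneg by (rule order.trans)
    qed
    then have "ereal (\<kappa> * W v) + ereal (\<alpha> / 2 * (L2_norm \<Omega> (\<lambda>x. g x - v x))\<^sup>2) \<le> functional_I \<Omega> \<alpha> g v"
      unfolding functional_I_def by (rule add_right_mono)
    \<comment> \<open>Completing the square; it works because \<open>\<kappa> = \<alpha> (1 - c)\<close>.\<close>
    moreover have "K + \<alpha> / 2 * Q v = \<kappa> * W v + \<alpha> / 2 * (L2_norm \<Omega> (\<lambda>x. g x - v x))\<^sup>2"
      unfolding Q L K_def \<kappa>_def m_def by (simp add: power2_eq_square field_simps)
    ultimately show "ereal (K + \<alpha> / 2 * Q v) \<le> functional_I \<Omega> \<alpha> g v" by simp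
  qed
  have "functional_I \<Omega> \<alpha> g (\<lambda>x. c * g x) \<le> ereal (\<kappa> * c * G) + ereal (\<alpha> / 2 * (m\<^sup>2 * G))"
  proof -
    have "(L2_norm \<Omega> (\<lambda>x. g x - c * g x))\<^sup>2 = (LINT x|lebesgue_on \<Omega>. m\<^sup>2 * (g x)\<^sup>2)"
      unfolding L2_norm_square m_def by (simp add: power2_eq_square algebra_simps)
    then have eq: "(L2_norm \<Omega> (\<lambda>x. g x - c * g x))\<^sup>2 = m\<^sup>2 * G"
      by (simp add: G_def)
    have tv: "total_variation \<Omega> (\<lambda>x. c * g x) \<le> ereal (4 * pi * r * c)"
      unfolding g by (rule total_variation_scaled_balls_le[OF op r c sub])
    show ?thesis
      unfolding functional_I_def eq \<kappa>c[symmetric] by (rule add_right_mono[OF tv])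
  qed
  then have upper: "functional_I \<Omega> \<alpha> g (\<lambda>x. c * g x) \<le> ereal K"
    by (simp add: K_def mult.assoc)
  have Q0: "Q v \<ge> 0" for v by (simp add: Q_def)
  have min: "is_minimizer \<Omega> \<alpha> g (\<lambda>x. c * g x)"
    unfolding is_minimizer_def
  proof (intro conjI ballI adm)
    fix v assume "v \<in> admissible \<Omega>"
    have "ereal K \<le> ereal (K + \<alpha> / 2 * Q v)" using Q0[of v] \<alpha> by simp
    with upper lower[OF \<open>v \<in> admissible \<Omega>\<close>]
    show "functional_I \<Omega> \<alpha> g (\<lambda>x. c * g x) \<le> functional_I \<Omega> \<alpha> g v"
      by (meson order.trans)
  qed
  moreover have "AE x in lebesgue_on \<Omega>. u x = c * g x" if u: "is_minimizer \<Omega> \<alpha> g u" for u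
  proof -
    have ua: "u \<in> admissible \<Omega>" and "functional_I \<Omega> \<alpha> g u \<le> functional_I \<Omega> \<alpha> g (\<lambda>x. c * g x)"
      using u adm by (auto simp: is_minimizer_def)
    then have "ereal (K + \<alpha> / 2 * Q u) \<le> ereal K"
      using lower[OF ua] upper by (meson order.trans)
    then have "\<alpha> / 2 * Q u \<le> 0" by simp
    then have "Q u = 0" using Q0[of u] \<alpha> by (simp add: mult_le_0_iff)
    then have "AE x in lebesgue_on \<Omega>. (u x - c * g x)\<^sup>2 = 0"
      unfolding Q_def by (subst (asm) integral_nonneg_eq_0_iff_AE[OF Qi[OF ua]]) auto
    then show ?thesis by simp
  qed
  ultimately show ?thesis by blast
qed

end
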